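(* Let $m\ge 2$ and $I\in\mathcal{I}_m$. If $s_I<m$ then $c(\textsc{AdSch},I)\le \phi(m-s_I)\cdot opt(I)$, and if $s_I=m$ then $c(\textsc{AdSch},I)\le (3+2e)\, opt(I)$. Moreover, for every search strategy $\Sigma$ and every $s\in\{1,\dots,m-1\}$ there exists $I\in\mathcal{I}_m$ with $s_I=s$ such that $c(\Sigma,I)\ge \phi(m-s_I)\cdot opt(I)$, and there exists $I\in\mathcal{I}_m$ with $s_I=m$ such that $c(\Sigma,I)\ge 2\,opt(I)$.
   Context: Weighted search on $m$ rays: a star consists of $m$ infinite rays $0,\dots,m-1$ with common origin $O$. An instance is $I=(W,(d_i,w_i)_{0\le i\le m-1})$ with $W\ge 0$, weights $w_i \ge 0$, distances $d_i \in [1,\infty]$ ($d_i=\infty$ meaning no target), and $\sum_i w_i \ge W$; the set of all such instances is $\mathcal{I}_m$. On ray $i$ a target of weight $w_i$ is hidden at distance $d_i$ from $O$. A searcher starts at $O$ with no knowledge of the instance. A (deterministic) search strategy chooses, each time the searcher is at $O$, a ray $r$ and a depth $l_r$ (possibly depending on everything observed so far); the searcher walks along $r$ up to depth $l_r$ and returns to $O$, except that if it meets the target of $r$ it immediately returns to $O$ and never searches $r$ again. The cost $c(\Sigma,I)$ is the total distance traversed until the first moment the discovered targets have aggregate weight at least $W$. For $S\subseteq\{0,\dots,m-1\}$ let $w_S=\sum_{i\in S}w_i$ and $d_S = 2\sum_{i\in S} d_i - \max_{i\in S} d_i$; then $opt(I)=\min\{d_S : w_S \ge W\}$, and $s_I=\max\{|S|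 : w_S\ge W,\ d_S=opt(I)\}$. For $x>0$ let $b_x = 1+1/x$ and $\phi(x) = 1+2(1+x)(1+1/x)^x = 1 + 2 b_x^{x+1}/(b_x-1)$. For $1\le f\le m$ write $b_{m,f}=b_{m-f}=1+\frac{1}{m-f}$. Strategy $\textsc{AdSub}$: maintain $f=1$ (one plus the number of targets found), a current ray index $r=0$, and $D=1$; the remaining rays are labelled $0,\dots,m-f$ in their original relative order. Repeatedly: explore ray $r$ up to distance $D\cdot b_{m,f}$ or until a target is found (when $f=m$, only one ray remains and it is explored until its target is found). If no target is found, set $r \leftarrow r+1 \pmod{m-f+1}$ and $D\leftarrow D\cdot b_{m,f}$. If a target is found, set $f\leftarrow f+1$ (leaving $D$ unchanged), remove ray $r$, relabel the remaining rays $0,\dots,m-f$ preserving their relative order, and set $r\leftarrow r \pmod{m-f+1}$. Strategy $\textsc{AdSch}$ for weighted search executes $\textsc{AdSub}$ (ignoring weights) and stops as soon as the discovered targets have aggregate weight at least $W$.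
   Formalization: The lower bound c(Σ,I) ≥ φ(m−s_I)·opt(I) is proved as c(Σ,I) ≥ (φ(m−s_I)−ε)·opt(I) for every ε>0; exact attainment is false, e.g. for s=1 cyclic search with depths b^j, b=1+1/(m−1), always costs strictly less. *)

theory Defs
  imports "HOL-Analysis.Analysis"
begin

text \<open>Rays are the natural numbers below \<open>m\<close>; the values of \<open>distance\<close> and \<open>weight\<close> at other
  indices are irrelevant. The distance \<open>\<infinity>\<close> means that the ray holds no target.\<close>

record star_instance =
  threshold :: real
  distance :: "nat \<Rightarrow> ereal"
  weight :: "nat \<Rightarrow> real"

definition instances :: "nat \<Rightarrow> star_instance set" where
  "instances m = {I. 0 \<le> threshold I
     \<and> (\<forall>i<m. 1 \<le> distance I i \<and> 0 \<le> weight I i)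
     \<and> threshold I \<le> (\<Sum>i<m. weight I i)}"

definition set_weight :: "star_instance \<Rightarrow> nat set \<Rightarrow> real" where
  "set_weight I S = (\<Sum>i\<in>S. weight I i)"

text \<open>The empty set has distance 0. Since \<open>\<infinity> - \<infinity> = \<infinity>\<close> in \<^typ>\<open>ereal\<close>, a set that contains a ray
  without target has distance \<open>\<infinity>\<close>.\<close>

definition set_dist :: "star_instance \<Rightarrow> nat set \<Rightarrow> ereal" where
  "set_dist I S =
     (if S = {} then 0 else 2 * (\<Sum>i\<in>S. distance I i) - Max (distance I ` S))"

definition feasible :: "nat \<Rightarrow> star_instance \<Rightarrow> nat set set" where
  "feasible m I = {S. S \<subseteq> {..<m} \<and> threshold I \<le> set_weight I S}"

definition opt :: "nat \<Rightarrow> star_instance \<Rightarrow> ereal" where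
  "opt m I = Min (set_dist I ` feasible m I)"

definition opt_size :: "nat \<Rightarrow> star_instance \<Rightarrow> nat" where
  "opt_size m I = Max (card ` {S \<in> feasible m I. set_dist I S = opt m I})"

text \<open>An observation \<open>(r, x, z)\<close> records one round trip from the origin: the ray \<open>r\<close>, the distance
  \<open>x\<close> at which the searcher turned back, and \<open>z = Some w\<close> if it did so because it met a target, of
  weight \<open>w\<close>. Histories list the most recent observation first. A strategy sees nothing but the
  history; in particular it does not know the threshold.\<close>

type_synonym observation = "nat \<times> ereal \<times> real option"
type_synonym history = "observation list"
type_synonym strategy = "history \<Rightarrow> nat \<times> ereal"

definition explore :: "star_instance \<Rightarrow> nat \<times> ereal \<Rightarrow> observation" where
  "explore I = (\<lambda>(r, l).
     if distance I r \<le> l \<and> distance I r < \<infinity>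
     then (r, distance I r, Some (weight I r)) else (r, l, None))"

primrec run :: "strategy \<Rightarrow> star_instance \<Rightarrow> nat \<Rightarrow> history" where
  "run \<Sigma> I 0 = []"
| "run \<Sigma> I (Suc n) = explore I (\<Sigma> (run \<Sigma> I n)) # run \<Sigma> I n"

definition found_rays :: "history \<Rightarrow> nat set" where
  "found_rays h = {r. \<exists>x w. (r, x, Some w) \<in> set h}"

definition found_weight :: "history \<Rightarrow> real" where
  "found_weight h = (\<Sum>(r, x, z)\<leftarrow>h. case z of None \<Rightarrow> 0 | Some w \<Rightarrow> w)"

text \<open>An infinite depth is a search of the ray until its target is found.\<close>

definition search_strategy :: "nat \<Rightarrow> strategy \<Rightarrow> bool" where
  "search_strategy m \<Sigma> \<longleftrightarrow>
     (\<forall>I\<in>instances m. \<forall>n. found_weight (run \<Sigma> I n) < threshold I \<longrightarrow>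
        (case \<Sigma> (run \<Sigma> I n) of (r, l) \<Rightarrow>
           r < m \<and> r \<notin> found_rays (run \<Sigma> I n) \<and> 0 \<le> l))"

definition finite_depths :: "nat \<Rightarrow> strategy \<Rightarrow> bool" where
  "finite_depths m \<Sigma> \<longleftrightarrow>
     (\<forall>I\<in>instances m. \<forall>n. found_weight (run \<Sigma> I n) < threshold I
        \<and> 2 \<le> card ({..<m} - found_rays (run \<Sigma> I n)) \<longrightarrow>
        snd (\<Sigma> (run \<Sigma> I n)) < \<infinity>)"

text \<open>The last trip counts only one way, as the search ends when the searcher meets its target.\<close>

fun travelled :: "history \<Rightarrow> ereal" where
  "travelled [] = 0"
| "travelled ((r, x, z) # h) = x + 2 * (\<Sum>(r', x', z')\<leftarrow>h. x')"

definition cost :: "strategy \<Rightarrow> star_instance \<Rightarrow> ereal" where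
  "cost \<Sigma> I =
     (if \<exists>n. threshold I \<le> found_weight (run \<Sigma> I n)
      then travelled (run \<Sigma> I (LEAST n. threshold I \<le> found_weight (run \<Sigma> I n)))
      else \<infinity>)"

definition base :: "real \<Rightarrow> real" where
  "base x = 1 + 1 / x"

definition phi :: "real \<Rightarrow> real" where
  "phi x = 1 + 2 * (1 + x) * (1 + 1 / x) powr x"

text \<open>The state \<open>(f, r, D, R)\<close> of \<open>AdSub\<close> consists of its three variables and the list \<open>R\<close> of
  remaining rays: the ray with current label \<open>j\<close> is \<open>R ! j\<close>.\<close>

fun AdSub_state :: "nat \<Rightarrow> history \<Rightarrow> nat \<times> nat \<times> real \<times> nat list" where
  "AdSub_state m [] = (1, 0, 1, [0..<m])"
| "AdSub_state m ((_, _, z) # h) =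
     (let (f, r, D, R) = AdSub_state m h in
      case z of
        None \<Rightarrow> (f, (r + 1) mod (m - f + 1), D * base (real (m - f)), R)
      | Some w \<Rightarrow> (let f' = f + 1 in
          (f', r mod (m - f' + 1), D, take r R @ drop (Suc r) R)))"

definition AdSub :: "nat \<Rightarrow> strategy" where
  "AdSub m h =
     (let (f, r, D, R) = AdSub_state m h in
      (R ! r, if f = m then \<infinity> else ereal (D * base (real (m - f)))))"

text \<open>\<open>AdSch\<close> makes the moves of \<open>AdSub\<close>; its stopping rule, discovered weight at least the
  threshold, is part of \<^const>\<open>cost\<close>.\<close>

definition AdSch :: "nat \<Rightarrow> strategy" where
  "AdSch m = AdSub m"

end

theory Submission
  imports Defs
begin

text \<open>Upper bound. The ray \<open>i\<close> nearest among the optimal set's rays not yet found has resisted every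
  visit so far, which bounds the current depth in terms of its distance \<open>d\<^sub>i\<close>. The finds in the optimal
  set are charged to their own distances, which costs a factor \<open>2 + 2 e\<close> each; the remaining trips
  behave like a search on the other rays for the single target \<open>i\<close>: finding a target outside the
  optimal set slows down the growth of the depths, and this outweighs the length of the trip to it.

  Lower bound. All weights are 1; \<open>s - 1\<close> targets at distance 1 are irrelevant in the long run, and the
  last one is put on one of \<open>k = m - s + 1\<close> further rays, just beyond the depth explored there. A bounded
  ratio means that the length of all trips is at most \<open>\<mu>\<close> times the smallest explored depth of these
  rays, hence at most \<open>\<mu>\<close> times the \<open>k\<close>th largest depth so far. After sorting, this is a delayed
  recurrence \<open>a\<^sub>0 + \<dots> + a\<^sub>i\<^sub>+\<^sub>k\<^sub>-\<^sub>1 \<le> \<mu> a\<^sub>i + C\<close>, whose solutions grow at an ever increasing rate if \<open>\<mu>\<close> is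
  below the optimal value. For \<open>s = m\<close> the adversary watches a search without targets until some trip
  is long, and puts each target slightly beyond the total depth spent on its ray.\<close>

section \<open>Elementary inequalities\<close>

text \<open>For \<open>n \<ge> 1\<close> the minimum of \<open>L ^ Suc n / (L - 1)\<close> over
  \<open>L > 1\<close>, attained at \<open>L = base n\<close>, so that
  \<open>1 + 2 * growth n\<close> is the ratio of geometric search on \<open>n + 1\<close> rays. At
  \<open>n = 0\<close>, where \<open>1 / 0 = 0\<close>, the value is 1, the infimum.\<close>

definition growth :: "nat \<Rightarrow> real" where
  "growth n = (real n + 1) * base (real n) ^ n"

lemma base_ge_1: "0 \<le> x \<Longrightarrow> 1 \<le> base x"
  by (simp add: base_def)

lemma base_antimono: "0 < x \<Longrightarrow> x \<le> y \<Longrightarrow> base y \<le> base x"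
  by (simp add: base_def frac_le)

lemma phi_eq_growth: "phi (real n) = 1 + 2 * growth n"
  by (cases n) (auto simp: phi_def growth_def base_def powr_realpow add_pos_nonneg simp del: of_nat_Suc)

lemma base_power_le_exp: "base (real n) ^ n \<le> exp 1"
proof (cases "n = 0")
  case False
  then show ?thesis using exp_ge_one_plus_x_over_n_power_n[of n 1] by (simp add: base_def)
qed (simp add: base_def)

lemma base_power_ge_2: "1 \<le> n \<Longrightarrow> 2 \<le> base (real n) ^ n"
  using Bernoulli_inequality[of "1 / real n" n] order_trans[of "-1" 0 "1 / real n"] by (simp add: base_def)

text \<open>The two bases differ by the factor \<open>1 - 1 / N^2\<close>. By Bernoulli its power
  with exponent \<open>l\<close> is at least \<open>N / (N + 1)\<close>, and the extra factor
  \<open>base N\<close> on the right compensates exactly this.\<close>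

lemma base_power_shift:
  assumes "2 \<le> N" "l \<le> N - 1"
  shows "base (real (N - 1)) ^ l \<le> base (real N) ^ Suc l"
proof -
  define x where "x = real N"
  have x: "x \<ge> 2" "real (N - 1) = x - 1" using assms by (auto simp: x_def of_nat_diff)
  have "1 - real l / x^2 \<le> (1 - 1 / x^2) ^ l"
  proof -
    have "1 \<le> x^2" using x by (simp add: one_le_power)
    then have "- 1 \<le> - (1 / x^2)" by (simp add: divide_le_eq)
    then show ?thesis using Bernoulli_inequality[of "- (1 / x^2)" l] by simp
  qed
  moreover have "real l / x^2 \<le> (x - 1) / x^2"
    using assms x by (intro divide_right_mono) (auto simp: x_def)
  moreover have "1 - (x - 1) / x^2 \<ge> x / (x + 1)"
    using x by (simp add: field_simps power2_eq_square)
  ultimately have "x / (x + 1) \<le> (1 - 1 / x^2) ^ l" by linarith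
  then have "x / (x + 1) * base (x - 1) ^ l \<le> (1 - 1 / x^2) ^ l * base (x - 1) ^ l"
    using x by (intro mult_right_mono) (auto simp: base_def)
  also have "\<dots> = base x ^ l"
    unfolding power_mult_distrib[symmetric]
    using x by (intro arg_cong[where f = "\<lambda>y. y ^ l"])
      (simp add: base_def field_simps power2_eq_square)
  finally have "base (x - 1) ^ l \<le> base x ^ l * ((x + 1) / x)"
    using x by (simp add: field_simps)
  also have "(x + 1) / x = base x" using x by (simp add: base_def field_simps)
  finally show ?thesis unfolding x(2) x_def[symmetric] by (simp add: mult.commute)
qed

text \<open>Pays for a find outside the optimal set, per unit of depth: the right side is the
  reserve before the find, the left side is the expense plus the reserve for one ray less. Raising
  \<open>q\<close> by one adds \<open>base (N - 1) ^ (q + 1)\<close> on the left and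
  \<open>base N ^ (q + 2)\<close> on the right, which \<open>base_power_shift\<close>
  compares.\<close>

lemma hit_trade:
  assumes "1 \<le> N" "q \<le> N - 1"
  shows "2 + 1 / real N + real N * base (real (N - 1)) ^ q \<le> (real N + 1) * base (real N) ^ Suc q"
  using assms(2)
proof (induction q)
  case 0
  then show ?case using assms(1) by (simp add: base_def field_simps)
next
  case (Suc q)
  have N: "2 \<le> N" using Suc.prems by linarith
  have 1: "real N * base (real (N - 1)) ^ Suc q
        = real N * base (real (N - 1)) ^ q + base (real (N - 1)) ^ Suc q"
  proof -
    have "real N * base (real (N - 1)) = real N + base (real (N - 1))"
      using N by (simp add: base_def of_nat_diff field_simps)
    then have "real N * base (real (N - 1)) * base (real (N - 1)) ^ q
        = (real N + base (real (N - 1))) * base (real (N - 1)) ^ q" by simp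
    then show ?thesis by (simp add: distrib_right mult.assoc)
  qed
  have 2: "(real N + 1) * base (real N) ^ Suc (Suc q)
        = (real N + 1) * base (real N) ^ Suc q + base (real N) ^ Suc (Suc q)"
  proof -
    have "(real N + 1) * base (real N) = real N + 1 + base (real N)"
      using N by (simp add: base_def field_simps)
    then have "(real N + 1) * base (real N) * base (real N) ^ Suc q
        = (real N + 1 + base (real N)) * base (real N) ^ Suc q" by simp
    then show ?thesis by (simp only: distrib_right mult.assoc power_Suc)
  qed
  have "base (real (N - 1)) ^ Suc q \<le> base (real N) ^ Suc (Suc q)"
    using base_power_shift[of N "Suc q"] N Suc.prems by auto
  moreover have "q \<le> N - 1" using Suc.prems by simp
  ultimately show ?case using Suc.IH 1 2 by linarith
qed

lemma growth_diff:
  assumes "1 \<le> N"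
  shows "2 + 1 / real N \<le> growth N - growth (N - 1)"
  using hit_trade[of N "N - 1"] assms by (simp add: growth_def of_nat_diff)

lemma growth_pos: "0 < growth n"
  by (simp add: growth_def base_def add_pos_nonneg)

lemma growth_upper: "growth n \<le> (real n + 1) * exp 1"
  unfolding growth_def using base_power_le_exp[of n] by (intro mult_left_mono) auto

lemma growth_lower: "1 \<le> n \<Longrightarrow> 2 * (real n + 1) \<le> growth n"
  using mult_left_mono[OF base_power_ge_2[of n], of "real n + 1"] by (simp add: growth_def mult.commute)

lemma growth_mono: "k \<le> n \<Longrightarrow> growth k \<le> growth n"
proof (induction n)
  case (Suc n)
  have "0 \<le> 1 / real (Suc n)" by simp
  moreover have "2 + 1 / real (Suc n) \<le> growth (Suc n) - growth n"
    using growth_diff[of "Suc n"] by (simp del: of_nat_Suc)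
  ultimately have "growth n \<le> growth (Suc n)" by linarith
  then show ?case using Suc by (cases "k = Suc n") auto
qed auto

text \<open>If \<open>u + 1\<close> optimal rays are missing, the nearest at distance
  \<open>d\<close>, they account for at least \<open>(2 * u + 1) * d\<close> of the optimum. This
  offsets the larger ratio, and for \<open>u \<ge> 1\<close> the crude bounds of
  \<open>growth\<close> between 2 and 3 times \<open>n + 1\<close> suffice.\<close>

lemma phi_scale:
  assumes "1 \<le> n"
  shows "phi (real (n + u)) \<le> (2 * real u + 1) * phi (real n)"
proof (cases "u = 0")
  case False
  then have u: "1 \<le> real u" by simp
  have "phi (real (n + u)) \<le> 1 + 2 * ((real (n + u) + 1) * exp 1)"
    using growth_upper[of "n + u"] by (simp only: phi_eq_growth)
  also have "\<dots> \<le> 1 + 2 * ((real (n + u) + 1) * 3)"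
    using exp_le by (intro add_left_mono mult_left_mono) auto
  also have "\<dots> \<le> (2 * real u + 1) * (1 + 2 * (2 * (real n + 1)))"
  proof -
    have "real u * real n \<ge> 1 * real n" using u by (intro mult_right_mono) auto
    then show ?thesis using u by (simp add: algebra_simps)
  qed
  also have "\<dots> \<le> (2 * real u + 1) * phi (real n)"
    unfolding phi_eq_growth using growth_lower[OF assms] by (intro mult_left_mono) auto
  finally show ?thesis .
qed simp

lemma phi_ge_9: "1 \<le> n \<Longrightarrow> 9 \<le> phi (real n)"
  using growth_lower[of n] unfolding phi_eq_growth by simp

section \<open>Trips of the adaptive strategy\<close>

text \<open>The run of \<open>AdSub\<close> as long as at least two rays remain before every trip: \<open>t\<close> trips have been
  made, of total one-way length \<open>A\<close>; \<open>Q\<close> lists the remaining rays in the order of their next visits,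
  and \<open>F\<close> is the set of rays whose targets were found.\<close>

inductive sweep ::
  "nat \<Rightarrow> (nat \<Rightarrow> ereal) \<Rightarrow> nat \<Rightarrow> nat list \<Rightarrow> nat set \<Rightarrow> real \<Rightarrow> real \<Rightarrow> bool"
  for m d where
  init: "sweep m d 0 [0..<m] {} 1 0"
| miss: "sweep m d t (j # Q) F D A \<Longrightarrow> Q \<noteq> [] \<Longrightarrow> ereal (D * base (length Q)) < d j \<Longrightarrow>
    sweep m d (Suc t) (Q @ [j]) F (D * base (length Q)) (A + D * base (length Q))"
| hit: "sweep m d t (j # Q) F D A \<Longrightarrow> Q \<noteq> [] \<Longrightarrow> d j = ereal x \<Longrightarrow> x \<le> D * base (length Q) \<Longrightarrow>
    sweep m d (Suc t) Q (insert j F) D (A + x)"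

lemma sweep_rays:
  "sweep m d t Q F D A \<Longrightarrow> distinct Q \<and> set Q = {..<m} - F \<and> F \<subseteq> {..<m}"
proof (induction rule: sweep.induct)
  case (hit t j Q F D A x)
  have "j \<in> {..<m} - F" using hit by (metis list.set_intros(1))
  moreover have "set Q = set (j # Q) - {j}" using hit by auto
  ultimately show ?case using hit by auto
qed auto

lemma sweep_D_ge_1: "sweep m d t Q F D A \<Longrightarrow> 1 \<le> D"
proof (induction rule: sweep.induct)
  case (miss t j Q F D A)
  then show ?case using mult_mono[of 1 D 1 "base (length Q)"] base_ge_1[of "length Q"] by simp
qed auto

text \<open>Serves termination: a bound on the length of all trips bounds their number.\<close>

lemma sweep_length_ge:
  assumes "sweep m d t Q F D A" "\<forall>j<m. 1 \<le> d j"
  shows "real t \<le> A"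
  using assms
proof (induction rule: sweep.induct)
  case (miss t j Q F D A)
  have "1 \<le> D * base (length Q)"
    using mult_mono[of 1 D 1 "base (length Q)"] base_ge_1[of "length Q"] sweep_D_ge_1[OF miss(1)] by simp
  then show ?case using miss by simp
next
  case (hit t j Q F D A x)
  have "j < m" using sweep_rays[OF hit(1)] by auto
  then have "1 \<le> x" using hit by (metis ereal_less_eq(3) one_ereal_def)
  then show ?case using hit by simp
qed auto

text \<open>The last visit to \<open>j\<close> stopped short of \<open>x\<close>; before any visit,
  the initial depth 1 is at most \<open>x\<close>. Since then \<open>D\<close> has grown only
  through misses on rays now behind \<open>j\<close>, one factor each. Finds in front of
  \<open>j\<close> shorten the queue, so the current base is at least every base used
  meanwhile.\<close>

lemma sweep_depth_bound:
  assumes "sweep m d t Q F D A" and ge_1: "\<forall>j<m. 1 \<le> d j"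
    and "Q = xs @ j # ys" and x: "d j = ereal x"
  shows "D \<le> x * base (length xs + length ys) ^ length ys"
  using assms(1,3)
proof (induction arbitrary: xs ys rule: sweep.induct)
  case init
  have "j \<in> set [0..<m]" using init by simp
  then have "1 \<le> x" using ge_1 x by (metis atLeast_upt ereal_less_eq(3) lessThan_iff one_ereal_def)
  moreover have "1 \<le> base (length xs + length ys) ^ length ys" by (simp add: base_ge_1)
  ultimately show ?case using mult_mono[of 1 x 1 "base (length xs + length ys) ^ length ys"] by simp
next
  case (miss t k Q F D A)
  show ?case
  proof (cases ys rule: rev_cases)
    case Nil
    then have "k = j" "Q = xs" using miss.prems by auto
    then show ?thesis using miss.hyps x Nil by simp
  next
    case (snoc zs z)
    then have "k # Q = (k # xs) @ j # zs" using miss.prems by auto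
    then have "D \<le> x * base (length (k # xs) + length zs) ^ length zs"
      by (rule miss.IH)
    then have "D \<le> x * base (length xs + length ys) ^ length zs"
      using snoc by simp
    moreover have "length Q = length xs + length ys" using miss.prems snoc by auto
    moreover have "0 \<le> base (length xs + length ys)"
      using base_ge_1[of "length xs + length ys"] by simp
    ultimately have "D * base (length Q)
        \<le> x * base (length xs + length ys) ^ length zs * base (length xs + length ys)"
      by (simp add: mult_right_mono)
    then show ?thesis using snoc by (simp add: mult_ac)
  qed
next
  case (hit t k Q F D A y)
  have *: "D \<le> x * base (Suc (length xs + length ys)) ^ length ys"
    using hit.IH[of "k # xs" ys] hit.prems by simp
  have "1 \<le> D" using sweep_D_ge_1[OF hit(1)] .
  then have "0 < x * base (Suc (length xs + length ys)) ^ length ys" using * by linarith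
  then have pos: "0 \<le> x"
    by (smt (verit) base_ge_1 of_nat_0_le_iff zero_less_mult_iff zero_less_power)
  show ?case
  \<comment> \<open>For \<open>ys = []\<close> both powers are 1. Otherwise the argument of
    \<open>base\<close> is positive, as its antitonicity requires, since
    \<open>base 0 = 1\<close>.\<close>
  proof (cases "ys = []")
    case False
    then have "base (Suc (length xs + length ys)) \<le> base (length xs + length ys)"
      by (intro base_antimono) (cases ys, auto)
    then have "base (Suc (length xs + length ys)) ^ length ys \<le> base (length xs + length ys) ^ length ys"
      by (smt (verit, best) base_ge_1 of_nat_0_le_iff power_mono)
    then have "x * base (Suc (length xs + length ys)) ^ length ys \<le> x * base (length xs + length ys) ^ length ys"
      using pos by (rule mult_left_mono)
    then show ?thesis using * by linarith
  qed (use * in simp)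
qed

text \<open>All other rays are behind \<open>j\<close>, so
  \<open>D \<le> x * base n ^ n \<le> exp 1 * x\<close> with \<open>n = length Q\<close>. The sum
  \<open>x + D\<close> is the trip itself plus what the bound \<open>length Q * D\<close> loses when
  the queue shrinks.\<close>

lemma sweep_hit_charge:
  assumes "sweep m d t (j # Q) F D A" "\<forall>j<m. 1 \<le> d j" "d j = ereal x"
  shows "x + D \<le> (1 + exp 1) * x"
proof -
  have "j < m" using sweep_rays[OF assms(1)] by auto
  then have "1 \<le> x" using assms by (metis ereal_less_eq(3) one_ereal_def)
  moreover have "D \<le> x * base (length Q) ^ length Q"
    using sweep_depth_bound[OF assms(1,2), of "[]" j Q] assms(3) by simp
  ultimately have "D \<le> x * exp 1"
    using base_power_le_exp[of "length Q"] mult_left_mono[of "base (length Q) ^ length Q" "exp 1" x] by linarith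
  then show ?thesis by (simp add: algebra_simps)
qed

text \<open>The number of rays that would remain, not counting that of the target \<open>i\<close>, if all rays in \<open>Y\<close> had
  been removed at the outset; the finds on \<open>Y\<close> are paid for by \<open>charge\<close>.\<close>

definition budget :: "nat \<Rightarrow> nat set \<Rightarrow> nat set \<Rightarrow> nat" where
  "budget m Y F = m - 1 - card Y - card (F - Y)"

text \<open>The truncated subtractions are exact because \<open>i\<close> lies outside both
  \<open>Y\<close> and \<open>insert j F\<close>, which leaves a unit to spend.\<close>

lemma budget_hit:
  assumes "i < m" "i \<notin> Y" "Y \<subseteq> {..<m}" "insert j F \<subseteq> {..<m}" "i \<notin> insert j F" "j \<notin> F" "j \<notin> Y"
  shows "budget m Y F = Suc (budget m Y (insert j F))"
proof -
  have fin: "finite Y" "finite F" using assms by (meson finite_insert finite_lessThan finite_subset)+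
  have "card Y + card (insert j F - Y) = card (Y \<union> insert j F)"
    using card_Un_disjoint[of Y "insert j F - Y"] fin by (simp add: Un_Diff_cancel)
  also have "\<dots> \<le> card ({..<m} - {i})" using assms by (intro card_mono) auto
  finally have "card Y + card (insert j F - Y) \<le> m - 1" using assms by simp
  moreover have "card (insert j F - Y) = Suc (card (F - Y))"
    using assms fin by (simp add: insert_Diff_if)
  ultimately show ?thesis by (simp add: budget_def)
qed

text \<open>Rays of \<open>Y\<close> not yet found are queued without being budgeted. Hence the base
  in use is at most that of the budget, as long as the budget is positive.\<close>

lemma budget_le:
  assumes "sweep m d t (j # Q) F D A" "Y \<subseteq> {..<m}"
  shows "budget m Y F \<le> length Q"
proof -
  note r = sweep_rays[OF assms(1)]
  have fin: "finite Y" "finite F" using assms r by (meson finite_lessThan finite_subset)+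
  have "Suc (length Q) = card ({..<m} - F)" using r by (metis distinct_card length_Cons)
  also have "\<dots> = m - card F" using r fin by (simp add: card_Diff_subset)
  finally have "Suc (length Q) = m - card F" .
  moreover have "card F \<le> card (Y \<union> (F - Y))" using fin by (intro card_mono) auto
  then have "card F \<le> card Y + card (F - Y)" using card_Un_le[of Y "F - Y"] by linarith
  ultimately show ?thesis by (simp add: budget_def)
qed

text \<open>The factor \<open>1 + exp 1\<close> is that of \<open>sweep_hit_charge\<close>; counting
  trips both ways doubles it.\<close>

definition charge :: "(nat \<Rightarrow> ereal) \<Rightarrow> nat set \<Rightarrow> nat set \<Rightarrow> real" where
  "charge d Y F = (1 + exp 1) * (\<Sum>j\<in>Y \<inter> F. real_of_ereal (d j))"

lemma charge_hit:
  assumes "sweep m d t (j # Q) F D A" "\<forall>j<m. 1 \<le> d j" "d j = ereal x"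
  shows "j \<in> Y \<Longrightarrow> charge d Y F + x + D \<le> charge d Y (insert j F)"
    and "j \<notin> Y \<Longrightarrow> charge d Y (insert j F) = charge d Y F"
proof -
  have "j \<notin> F" "finite F" using sweep_rays[OF assms(1)] finite_subset by auto
  then have "(\<Sum>k\<in>Y \<inter> insert j F. real_of_ereal (d k)) = x + (\<Sum>k\<in>Y \<inter> F. real_of_ereal (d k))"
    if "j \<in> Y" using that assms(3) by (simp add: Int_insert_right)
  then show "j \<in> Y \<Longrightarrow> charge d Y F + x + D \<le> charge d Y (insert j F)"
    using sweep_hit_charge[OF assms] by (simp add: charge_def distrib_left)
qed (simp add: charge_def)

text \<open>Makes a miss neutral: with \<open>n = length Q\<close> and \<open>b = base n\<close>,
  the trip length satisfies \<open>(n + 1) * D + D * b = (n + 1) * (D * b)\<close>.\<close>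

lemma miss_identity: "Q \<noteq> [] \<Longrightarrow> real (length Q) * base (length Q) = real (Suc (length Q))"
  by (simp add: base_def field_simps)

text \<open>An amortized count: a miss adds the same to \<open>A\<close> and to
  \<open>length Q * D\<close>, a find on \<open>Y\<close> is paid by \<open>charge\<close>, and a
  find elsewhere costs at most \<open>(2 + 1 / length Q) * D\<close>, which the drop of
  \<open>growth (budget m Y F)\<close> covers by \<open>growth_diff\<close>.\<close>

lemma sweep_bound_depth:
  assumes "sweep m d t Q F D A" "\<forall>j<m. 1 \<le> d j" "Y \<subseteq> {..<m}" "i \<notin> Y" "i \<in> set Q"
  shows "A \<le> real (length Q) * D + charge d Y F + (growth (m - 1 - card Y) - growth (budget m Y F)) * D"
  using assms(1,5)
proof (induction rule: sweep.induct)
  case init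
  then show ?case by (simp add: budget_def charge_def)
next
  case (miss t j Q F D A)
  let ?b = "base (length Q)" and ?g = "growth (m - 1 - card Y) - growth (budget m Y F)"
  have "D \<ge> 1" using sweep_D_ge_1[OF miss(1)] .
  have "1 \<le> ?b" by (simp add: base_ge_1)
  have "0 \<le> ?g" using growth_mono[of "budget m Y F" "m - 1 - card Y"] by (simp add: budget_def)
  then have "?g * D * 1 \<le> ?g * D * ?b"
    using \<open>1 \<le> ?b\<close> \<open>1 \<le> D\<close> by (intro mult_left_mono) auto
  moreover have "A \<le> real (Suc (length Q)) * D + charge d Y F + ?g * D" using miss by simp
  moreover have "real (Suc (length Q)) * D + D * ?b = real (Suc (length Q)) * (D * ?b)"
    by (simp flip: miss_identity[OF miss(2)] add: algebra_simps) (use miss_identity[OF miss(2)] in \<open>simp add: algebra_simps\<close>)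
  ultimately show ?case by (simp add: mult_ac)
next
  case (hit t j Q F D A x)
  let ?g = "\<lambda>F. growth (m - 1 - card Y) - growth (budget m Y F)"
  have D: "D \<ge> 1" using sweep_D_ge_1[OF hit(1)] .
  have IH: "A \<le> real (Suc (length Q)) * D + charge d Y F + ?g F * D" using hit by simp
  show ?case
  proof (cases "j \<in> Y")
    case True
    then have "insert j F - Y = F - Y" by auto
    then have "budget m Y (insert j F) = budget m Y F" by (simp add: budget_def)
    then show ?thesis using IH charge_hit(1)[OF hit(1) assms(2) hit(3) True] by (simp add: algebra_simps)
  next
    case False
    note r = sweep_rays[OF hit(1)]
    have "budget m Y F = Suc (budget m Y (insert j F))"
      using r False hit.prems assms by (intro budget_hit[of i]) auto
    then have "2 + 1 / real (budget m Y F) \<le> growth (budget m Y F) - growth (budget m Y (insert j F))"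
      using growth_diff[of "budget m Y F"] by simp
    moreover have "1 / real (length Q) \<le> 1 / real (budget m Y F)"
      using budget_le[OF hit(1) assms(3)] \<open>budget m Y F = Suc _\<close> by (intro frac_le) auto
    ultimately have "(2 + 1 / real (length Q)) * D \<le> (?g (insert j F) - ?g F) * D"
      using D by (intro mult_right_mono) auto
    moreover have "x \<le> D * (1 + 1 / real (length Q))" using hit by (simp add: base_def)
    ultimately show ?thesis using IH charge_hit(2)[OF hit(1) assms(2) hit(3) False]
      by (simp add: algebra_simps)
  qed
qed

text \<open>The second term on the left is a reserve. With \<open>N = budget m Y F\<close> it equals
  \<open>growth N * D\<close> right after a miss on \<open>i\<close>, when the depth bound and
  \<open>D \<le> \<delta>\<close> cover it. Each later miss multiplies \<open>D\<close> by at most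
  \<open>base N\<close> and lowers the exponent by one, so the reserve does not grow; a find outside
  \<open>Y\<close> is paid from it by \<open>hit_trade\<close>.\<close>

lemma sweep_bound_target:
  assumes "sweep m d t Q F D A" and ge_1: "\<forall>j<m. 1 \<le> d j" and Y: "Y \<subseteq> {..<m}" "i \<notin> Y"
    and "Q = xs @ i # ys" and \<delta>: "d i = ereal \<delta>" and "length ys \<le> budget m Y F"
  shows "A + real (Suc (budget m Y F)) * D * base (budget m Y F) ^ (budget m Y F - length ys)
      \<le> real (length Q) * D + charge d Y F + growth (m - 1 - card Y) * \<delta>"
  using assms(1,5,7)
proof (induction arbitrary: xs ys rule: sweep.induct)
  case init
  have i: "i < m" using init by (metis atLeast_upt in_set_conv_decomp lessThan_iff)
  then have "1 \<le> \<delta>" using ge_1 \<delta> by (metis ereal_less_eq(3) one_ereal_def)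
  let ?N = "m - 1 - card Y"
  have "real (Suc ?N) * base ?N ^ (?N - length ys) \<le> growth ?N"
    unfolding growth_def using base_ge_1[of ?N]
    by (intro mult_mono power_increasing) auto
  also have "\<dots> \<le> growth ?N * \<delta>" using \<open>1 \<le> \<delta>\<close> growth_pos[of ?N] mult_left_mono[of 1 \<delta> "growth ?N"] by simp
  finally show ?case by (simp add: budget_def charge_def)
next
  case (miss t k Q F D A)
  let ?b = "base (length Q)" and ?N = "budget m Y F"
  have "1 \<le> D" using sweep_D_ge_1[OF miss(1)] .
  have "1 \<le> ?b" by (simp add: base_ge_1)
  show ?case
  proof (cases ys rule: rev_cases)
    \<comment> \<open>The trip went to \<open>i\<close> itself. In the depth bound after the trip,
      \<open>growth ?N * ?D\<close> moves to the left as the new reserve, and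
      \<open>?D \<le> \<delta>\<close> replaces the remaining depth by
      \<open>\<delta>\<close>.\<close>
    case Nil
    then have k: "k = i" "Q = xs" using miss.prems by auto
    let ?D = "D * ?b"
    have "A + ?D \<le> real (length (Q @ [k])) * ?D + charge d Y F + (growth (m - 1 - card Y) - growth ?N) * ?D"
      using sweep_bound_depth[OF sweep.miss[OF miss(1-3)] ge_1 Y] k by simp
    moreover have "?D \<le> \<delta>" using miss(3) k \<delta> by simp
    then have "growth (m - 1 - card Y) * ?D \<le> growth (m - 1 - card Y) * \<delta>"
      using growth_pos less_imp_le by (intro mult_left_mono) auto
    moreover have "real (Suc ?N) * ?D * base ?N ^ (?N - length ys) = growth ?N * ?D"
      using Nil by (simp add: growth_def)
    ultimately show ?thesis by (simp add: algebra_simps)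
  next
    case (snoc zs z)
    then have "k # Q = (k # xs) @ i # zs" using miss.prems by auto
    from miss.IH[OF this] have IH: "A + real (Suc ?N) * D * base ?N ^ (?N - length zs)
        \<le> real (Suc (length Q)) * D + charge d Y F + growth (m - 1 - card Y) * \<delta>"
      using miss.prems snoc by simp
    \<comment> \<open>The budget is positive here because \<open>ys\<close> is nonempty and not
      longer than it.\<close>
    have "?b \<le> base ?N"
      using budget_le[OF miss(1) Y(1)] miss.prems snoc by (intro base_antimono) auto
    then have "?b * base ?N ^ (?N - length ys) \<le> base ?N * base ?N ^ (?N - length ys)"
      by (intro mult_right_mono) (simp_all add: base_def)
    also have "\<dots> = base ?N ^ (?N - length zs)"
      using miss.prems snoc by (simp flip: power_Suc add: Suc_diff_Suc)
    finally have "real (Suc ?N) * D * (?b * base ?N ^ (?N - length ys))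
        \<le> real (Suc ?N) * D * base ?N ^ (?N - length zs)"
      using \<open>1 \<le> D\<close> by (intro mult_left_mono) auto
    moreover have "real (Suc (length Q)) * D + D * ?b = real (Suc (length Q)) * (D * ?b)"
      by (simp flip: miss_identity[OF miss(2)] add: algebra_simps) (use miss_identity[OF miss(2)] in \<open>simp add: algebra_simps\<close>)
    ultimately show ?thesis using IH by (simp add: mult_ac)
  qed
next
  case (hit t k Q F D A x)
  have D: "D \<ge> 1" using sweep_D_ge_1[OF hit(1)] .
  have kQ: "k # Q = (k # xs) @ i # ys" using hit.prems by simp
  note r = sweep_rays[OF hit(1)]
  show ?case
  proof (cases "k \<in> Y")
    case True
    then have "insert k F - Y = F - Y" by auto
    then have "budget m Y (insert k F) = budget m Y F" by (simp add: budget_def)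
    then show ?thesis using hit.IH[OF kQ] hit.prems charge_hit(1)[OF hit(1) ge_1 hit(3) True]
      by (simp add: algebra_simps)
  next
    case False
    let ?N = "budget m Y F" and ?N' = "budget m Y (insert k F)"
    have "i \<in> set Q" "i \<noteq> k" using hit.prems r by auto
    then have N: "?N = Suc ?N'"
      using r False Y by (intro budget_hit[of i]) auto
    have IH: "A + real (Suc ?N) * D * base ?N ^ (?N - length ys)
        \<le> real (Suc (length Q)) * D + charge d Y F + growth (m - 1 - card Y) * \<delta>"
      using hit.IH[OF kQ] hit.prems N by simp
    have "?N - length ys = Suc (?N' - length ys)" using hit.prems N by simp
    then have "2 + 1 / real ?N + real ?N * base ?N' ^ (?N' - length ys)
        \<le> real (Suc ?N) * base ?N ^ (?N - length ys)"
      using hit_trade[of ?N "?N' - length ys"] N by (simp add: add.commute)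
    moreover have "1 / real (length Q) \<le> 1 / real ?N"
      using budget_le[OF hit(1) Y(1)] N by (intro frac_le) auto
    ultimately have "(2 + 1 / real (length Q) + real ?N * base ?N' ^ (?N' - length ys)) * D
        \<le> (real (Suc ?N) * base ?N ^ (?N - length ys)) * D"
      using D by (intro mult_right_mono) auto
    moreover have "x \<le> D * (1 + 1 / real (length Q))" using hit by (simp add: base_def)
    ultimately show ?thesis using IH charge_hit(2)[OF hit(1) ge_1 hit(3) False] 
      unfolding N[symmetric] by (simp add: algebra_simps)
  qed
qed

text \<open>Once all of \<open>Y\<close> is found, the budget is \<open>length Q - 1\<close>, and
  the reserve of \<open>sweep_bound_target\<close> absorbs \<open>length Q * D\<close>.\<close>

lemma sweep_length_le:
  assumes "sweep m d t Q F D A" "\<forall>j<m. 1 \<le> d j" "Y \<subseteq> F" "i < m" "i \<notin> F" "d i = ereal \<delta>"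
  shows "A \<le> growth (m - 1 - card Y) * \<delta> + (1 + exp 1) * (\<Sum>j\<in>Y. real_of_ereal (d j))"
proof -
  note r = sweep_rays[OF assms(1)]
  obtain xs ys where Q: "Q = xs @ i # ys"
    using r assms(4,5) by (metis DiffI in_set_conv_decomp lessThan_iff)
  have fin: "finite F" using r finite_subset by auto
  have "length Q = card ({..<m} - F)" using r by (metis distinct_card)
  also have "\<dots> = m - card F" using r fin by (simp add: card_Diff_subset)
  finally have "length xs + length ys = m - card F - 1" using Q by simp
  moreover have "card F = card Y + card (F - Y)" "card Y \<le> card F"
    using assms(3) fin card_mono[OF fin assms(3)] by (simp_all add: card_Diff_subset finite_subset)
  ultimately have N: "budget m Y F = length xs + length ys" by (simp add: budget_def)
  have "1 \<le> base (budget m Y F) ^ (budget m Y F - length ys)" by (simp add: base_ge_1)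
  then have "real (length Q) * D * 1
      \<le> real (Suc (budget m Y F)) * D * base (budget m Y F) ^ (budget m Y F - length ys)"
    using sweep_D_ge_1[OF assms(1)] N Q by (intro mult_mono) auto
  moreover have "Y \<inter> F = Y" "Y \<subseteq> {..<m}" "i \<notin> Y" using assms(3,5) r by auto
  ultimately show ?thesis
    using sweep_bound_target[OF assms(1,2) _ _ Q assms(6), of Y] N
    by (simp add: charge_def)
qed

section \<open>Cost of the adaptive strategy\<close>

text \<open>Turns labels into a queue: the remaining rays are read cyclically from the current label
  on, so a miss becomes a rotation and a find removes the head.\<close>

definition queued :: "nat \<Rightarrow> history \<Rightarrow> nat list \<Rightarrow> real \<Rightarrow> bool" where
  "queued m h Q D \<longleftrightarrow> (\<exists>f r R. AdSub_state m h = (f, r, D, R)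
     \<and> r < length R \<and> f + length R = Suc m \<and> Q = rotate r R)"

lemma queued_init: "0 < m \<Longrightarrow> queued m [] [0..<m] 1"
  by (simp add: queued_def)

lemma queued_move:
  assumes "queued m h (j # Q) D"
  shows "AdSub m h = (j, if Q = [] then \<infinity> else ereal (D * base (length Q)))"
proof -
  obtain f r R where s: "AdSub_state m h = (f, r, D, R)" "r < length R" "f + length R = Suc m"
    "j # Q = rotate r R" using assms by (auto simp: queued_def)
  have "R \<noteq> []" using s(2) by auto
  from hd_rotate_conv_nth[OF this, of r] have "R ! r = j" by (simp add: s(2) flip: s(4))
  moreover have "length R = Suc (length Q)" using s(4) by (metis length_Cons length_rotate)
  ultimately show ?thesis using s by (auto simp: AdSub_def)
qed

lemma queued_miss:
  assumes "queued m h (j # Q) D"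
  shows "queued m ((k, x, None) # h) (Q @ [j]) (D * base (length Q))"
proof -
  obtain f r R where s: "AdSub_state m h = (f, r, D, R)" "r < length R" "f + length R = Suc m"
    "j # Q = rotate r R" using assms by (auto simp: queued_def)
  have l: "length R = Suc (length Q)" using s(4) by (metis length_Cons length_rotate)
  have "rotate (Suc r mod length R) R = rotate1 (rotate r R)"
    unfolding rotate_Suc[symmetric] by (rule rotate_conv_mod[symmetric])
  then have "rotate (Suc r mod length R) R = Q @ [j]" by (simp flip: s(4))
  moreover have "m - f = length Q" using s(3) l by simp
  then have "AdSub_state m ((k, x, None) # h)
      = (f, Suc r mod length R, D * base (length Q), R)"
    by (simp add: s(1) l)
  moreover have "Suc r mod length R < length R" using l by simp
  ultimately show ?thesis unfolding queued_def using s(3) by metis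
qed

lemma queued_hit:
  assumes "queued m h (j # Q) D" "Q \<noteq> []"
  shows "queued m ((k, x, Some w) # h) Q D"
proof -
  obtain f r R where s: "AdSub_state m h = (f, r, D, R)" "r < length R" "f + length R = Suc m"
    "j # Q = rotate r R" using assms by (auto simp: queued_def)
  have l: "length R = Suc (length Q)" using s(4) by (metis length_Cons length_rotate)
  define R' where "R' = take r R @ drop (Suc r) R"
  have l': "length R' = length Q" using s(2) l by (simp add: R'_def)
  have "j # Q = drop r R @ take r R" using s by (simp add: rotate_drop_take)
  then have Q: "Q = drop (Suc r) R @ take r R"
    by (simp flip: Cons_nth_drop_Suc[OF s(2)])
  have "rotate (r mod length R') R' = Q"
  \<comment> \<open>The successor of the removed ray inherits its label, unless that label was the
    last one; then the reduction modulo the new length restarts at 0.\<close>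
  proof (cases "r = length Q")
    case True
    then have "drop (Suc r) R = []" using l by simp
    then have "R' = Q" unfolding R'_def by (subst Q) simp
    moreover have "r mod length R' = 0" using True l' by simp
    ultimately show ?thesis by simp
  next
    case False
    then have "r < length R'" using l l' s(2) by simp
    then have "rotate (r mod length R') R' = drop r R' @ take r R'" by (simp add: rotate_drop_take)
    then show ?thesis using s(2) unfolding Q by (simp add: R'_def)
  qed
  moreover have "m - (f + 1) + 1 = length R'" using s(3) l l' assms(2) by (cases Q) auto
  then have "AdSub_state m ((k, x, Some w) # h) = (f + 1, r mod length R', D, R')"
    by (simp add: s(1) R'_def)
  moreover have "r mod length R' < length R'" using l' assms(2) by simp
  moreover have "f + 1 + length R' = Suc m" using s(3) l l' by simp
  ultimately show ?thesis unfolding queued_def by metis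
qed

lemma found_rays_Cons:
  "found_rays ((r, x, z) # h) = (if z = None then found_rays h else insert r (found_rays h))"
  by (auto simp: found_rays_def)

lemma found_rays_run_mono: "found_rays (run \<Sigma> I t) \<subseteq> found_rays (run \<Sigma> I (Suc t))"
  by (auto simp: found_rays_def)

lemma run_sweep:
  assumes "I \<in> instances m" "i < m" "distance I i < \<infinity>"
    and "i \<notin> found_rays (run (AdSub m) I t)"
  shows "\<exists>Q D A. sweep m (distance I) t Q (found_rays (run (AdSub m) I t)) D A
    \<and> queued m (run (AdSub m) I t) Q D \<and> (\<Sum>(r, x, z)\<leftarrow>run (AdSub m) I t. x) = ereal A"
  using assms(4)
proof (induction t)
  case 0
  have "found_rays [] = {}" by (simp add: found_rays_def)
  then show ?case using assms(2) queued_init[of m] sweep.init[of m "distance I"]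
    by (intro exI[of _ "[0..<m]"] exI[of _ 1] exI[of _ 0]) (simp add: zero_ereal_def)
next
  case (Suc t)
  let ?h = "run (AdSub m) I t"
  obtain Q D A where q: "sweep m (distance I) t Q (found_rays ?h) D A" "queued m ?h Q D"
    "(\<Sum>(r, x, z)\<leftarrow>?h. x) = ereal A"
    using Suc.IH Suc.prems found_rays_run_mono[of "AdSub m" I t] by blast
  have i: "i \<in> set Q" using sweep_rays[OF q(1)] Suc.prems found_rays_run_mono[of "AdSub m" I t] assms(2) by blast
  then obtain j Q' where Q: "Q = j # Q'" by (cases Q) auto
  note move = queued_move[OF q(2)[unfolded Q]]
  \<comment> \<open>A single remaining ray would be \<open>i\<close>, and its search to infinite
    depth would find the target.\<close>
  have "Q' \<noteq> []"
  proof
    assume "Q' = []"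
    then show False using Suc.prems i Q move assms(3) by (auto simp: explore_def found_rays_Cons)
  qed
  have "j < m" using sweep_rays[OF q(1)] Q by auto
  then have "1 \<le> distance I j" using assms(1) by (auto simp: instances_def)
  show ?case
  proof (cases "distance I j \<le> ereal (D * base (length Q'))")
    case True
    then obtain x where x: "distance I j = ereal x"
      using \<open>1 \<le> distance I j\<close> by (cases "distance I j") auto
    have step: "run (AdSub m) I (Suc t) = (j, ereal x, Some (weight I j)) # ?h"
      using move x True \<open>Q' \<noteq> []\<close> by (simp add: explore_def)
    have "sweep m (distance I) (Suc t) Q' (insert j (found_rays ?h)) D (A + x)"
      using sweep.hit[OF q(1)[unfolded Q] \<open>Q' \<noteq> []\<close> x] True x by simp
    then show ?thesis
      unfolding step using queued_hit[OF q(2)[unfolded Q] \<open>Q' \<noteq> []\<close>] q(3)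
      by (intro exI[of _ Q'] exI[of _ D] exI[of _ "A + x"]) (simp add: found_rays_Cons add.commute)
  next
    case False
    let ?l = "D * base (length Q')"
    have step: "run (AdSub m) I (Suc t) = (j, ereal ?l, None) # ?h"
      using move False \<open>Q' \<noteq> []\<close> by (simp add: explore_def)
    have "sweep m (distance I) (Suc t) (Q' @ [j]) (found_rays ?h) ?l (A + ?l)"
      using sweep.miss[OF q(1)[unfolded Q] \<open>Q' \<noteq> []\<close>] False by simp
    then show ?thesis
      unfolding step using queued_miss[OF q(2)[unfolded Q]] q(3)
      by (intro exI[of _ "Q' @ [j]"] exI[of _ ?l] exI[of _ "A + ?l"]) (simp add: found_rays_Cons add.commute)
  qed
qed

lemma AdSub_run_move:
  assumes "I \<in> instances m" "i < m" "distance I i < \<infinity>"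
    and "i \<notin> found_rays (run (AdSub m) I t)"
  obtains j l where "AdSub m (run (AdSub m) I t) = (j, l)" "j < m" "0 \<le> l"
    "j \<notin> found_rays (run (AdSub m) I t)" "found_rays (run (AdSub m) I t) \<subseteq> {..<m}"
proof -
  let ?h = "run (AdSub m) I t"
  obtain Q D A where q: "sweep m (distance I) t Q (found_rays ?h) D A" "queued m ?h Q D"
    using run_sweep[OF assms] by blast
  have "i \<in> set Q" using sweep_rays[OF q(1)] assms(2,4) by blast
  then obtain j Q' where Q: "Q = j # Q'" by (cases Q) auto
  have "0 \<le> D * base (length Q')" using sweep_D_ge_1[OF q(1)] by (simp add: base_def)
  moreover have "j \<in> {..<m} - found_rays ?h" "found_rays ?h \<subseteq> {..<m}"
    using sweep_rays[OF q(1)] Q by auto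
  ultimately show ?thesis
    by (intro that[OF queued_move[OF q(2)[unfolded Q]]]) auto
qed

text \<open>No ray is searched again after its find, so no weight counts twice. The conclusion
  reaches one trip beyond the assumption, to include the trip that finds the last ray.\<close>

lemma run_found_weight:
  assumes "I \<in> instances m" "i < m" "distance I i < \<infinity>"
    and "i \<notin> found_rays (run (AdSub m) I t)"
  shows "found_weight (run (AdSub m) I (Suc t)) = sum (weight I) (found_rays (run (AdSub m) I (Suc t)))"
  using assms(4)
proof (induction t)
  case (Suc t)
  let ?h = "run (AdSub m) I (Suc t)"
  obtain j l where move: "AdSub m ?h = (j, l)" "j \<notin> found_rays ?h" "found_rays ?h \<subseteq> {..<m}"
    using AdSub_run_move[OF assms(1-3) Suc.prems] by metis
  have fin: "finite (found_rays ?h)" using move(3) by (rule finite_subset) simp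
  have IH: "found_weight ?h = sum (weight I) (found_rays ?h)"
    using Suc.IH Suc.prems found_rays_run_mono[of "AdSub m" I t] by blast
  then have "sum (weight I) (insert j (found_rays ?h)) = weight I j + sum (weight I) (found_rays ?h)"
    using move(2) fin by (simp del: run.simps)
  with IH show ?case
    unfolding run.simps(2)[of _ _ "Suc t"] move(1)
    by (auto simp: explore_def found_rays_Cons found_weight_def simp del: run.simps)
next
  case 0
  have "found_rays [] = {}" by (simp add: found_rays_def)
  then show ?case by (auto simp: explore_def found_rays_Cons found_weight_def split: prod.splits)
qed

text \<open>\<open>Y\<close> is the part of \<open>S\<close> found by the end and \<open>i\<close>
  the nearest missing ray. If the last trip completes \<open>S\<close>, the ray of that trip counts
  as missing.\<close>

lemma cost_AdSub_le:
  fixes m I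
  defines "d \<equiv> \<lambda>j. real_of_ereal (distance I j)"
  assumes I: "I \<in> instances m" "0 < threshold I"
    and S: "S \<subseteq> {..<m}" "threshold I \<le> set_weight I S" "\<And>j. j \<in> S \<Longrightarrow> distance I j < \<infinity>"
  obtains Y i where "Y \<subseteq> S" "i \<in> S - Y" "\<And>k. k \<in> S - Y \<Longrightarrow> d i \<le> d k"
    "cost (AdSub m) I \<le> ereal (phi (real (m - 1 - card Y)) * d i + (2 + 2 * exp 1) * sum d Y)"
proof -
  let ?h = "run (AdSub m) I"
  let ?F = "\<lambda>t. found_rays (?h t)"
  have ge_1: "\<forall>j<m. 1 \<le> distance I j" "\<And>j. j < m \<Longrightarrow> 0 \<le> weight I j"
    using I by (auto simp: instances_def)
  have finS: "finite S" using S(1) finite_subset by blast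
  have d: "distance I j = ereal (d j)" "1 \<le> d j" if "j \<in> S" for j
  proof -
    have "j < m" using that S(1) by auto
    then show "distance I j = ereal (d j)" using ge_1 S(3)[OF that] unfolding d_def
      by (cases "distance I j") fastforce+
    then show "1 \<le> d j" using ge_1 \<open>j < m\<close> by (metis ereal_less_eq(3) one_ereal_def)
  qed
  have least: "\<exists>i\<in>S - Y. \<forall>k\<in>S - Y. d i \<le> d k" if "\<not> S \<subseteq> Y" for Y
  proof -
    have "finite (d ` (S - Y))" "d ` (S - Y) \<noteq> {}" using that finS by auto
    from Min_in[OF this] obtain i where "i \<in> S - Y" "d i = Min (d ` (S - Y))" by force
    then show ?thesis using finS by (intro bexI[of _ i]) auto
  qed
  have trips: "\<exists>A. (\<Sum>(r, x, z)\<leftarrow>?h t. x) = ereal A \<and> real t \<le> A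
      \<and> (\<forall>Y\<subseteq>?F t. A \<le> growth (m - 1 - card Y) * d i + (1 + exp 1) * sum d Y)"
    if i: "i \<in> S" "i \<notin> ?F t" for i t
  proof -
    have "i < m" "distance I i < \<infinity>" using i S by auto
    from run_sweep[OF I(1) this i(2)] obtain Q D A where
      q: "sweep m (distance I) t Q (?F t) D A" "(\<Sum>(r, x, z)\<leftarrow>?h t. x) = ereal A" by blast
    then show ?thesis
      using sweep_length_ge[OF q(1) ge_1(1)] sweep_length_le[OF q(1) ge_1(1) _ \<open>i < m\<close> i(2) d(1)[OF i(1)]]
      unfolding d_def[symmetric] by blast
  qed
  \<comment> \<open>While a ray of \<open>S\<close> is missing, the bound with \<open>Y = {}\<close>
    limits the length of all trips independently of \<open>t\<close>, although this length is at
    least \<open>t\<close>.\<close>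
  have "\<exists>t. S \<subseteq> ?F t"
  proof (rule ccontr)
    assume never: "\<nexists>t. S \<subseteq> ?F t"
    have "real t \<le> growth (m - 1) * sum d S" for t
    proof -
      obtain i where i: "i \<in> S" "i \<notin> ?F t" using never by blast
      from trips[OF this] obtain A where
        "real t \<le> A" "\<forall>Y\<subseteq>?F t. A \<le> growth (m - 1 - card Y) * d i + (1 + exp 1) * sum d Y" by blast
      then have "real t \<le> growth (m - 1) * d i" by force
      also have "d i \<le> sum d S" using d(2) i finS by (intro member_le_sum) (auto intro: order_trans[of 0 1])
      then have "growth (m - 1) * d i \<le> growth (m - 1) * sum d S" using growth_pos[of "m - 1"] by simp
      finally show ?thesis .
    qed
    then show False by (meson not_le reals_Archimedean2)
  qed
  then obtain T where T: "S \<subseteq> ?F T" "\<And>t. t < T \<Longrightarrow> \<not> S \<subseteq> ?F t"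
    using exists_least_iff[of "\<lambda>t. S \<subseteq> ?F t"] by metis
  have "S \<noteq> {}" using I(2) S(2) by (auto simp: set_weight_def)
  then have "T \<noteq> 0" using T(1) by (auto simp: found_rays_def)
  then obtain T' where T': "T = Suc T'" by (cases T) auto
  then obtain i where i: "i \<in> S" "i \<notin> ?F T'" using T(2)[of T'] by auto
  have F: "?F T \<subseteq> {..<m}"
  proof -
    have "i < m" "distance I i < \<infinity>" using i S by auto
    from AdSub_run_move[OF I(1) this i(2)] obtain j l
      where "AdSub m (?h T') = (j, l)" "j < m" "?F T' \<subseteq> {..<m}" by metis
    then show ?thesis
      unfolding T' by (auto simp: explore_def found_rays_Cons)
  qed
  have "threshold I \<le> sum (weight I) S" using S by (simp add: set_weight_def)
  also have "\<dots> \<le> sum (weight I) (?F T)"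
    using T(1) F ge_1(2) by (intro sum_mono2) (auto intro: finite_subset)
  also have "\<dots> = found_weight (?h T)"
    unfolding T' using run_found_weight[OF I(1) _ _ i(2)] i S by auto
  finally have reached: "threshold I \<le> found_weight (?h T)" .
  define N where "N = (LEAST n. threshold I \<le> found_weight (?h n))"
  have "N \<le> T" unfolding N_def using reached by (rule Least_le)
  have "threshold I \<le> found_weight (?h N)" unfolding N_def using reached by (rule LeastI)
  have "N \<noteq> 0"
  proof
    assume "N = 0"
    then show False using \<open>threshold I \<le> found_weight (?h N)\<close> I(2) by (simp add: found_weight_def)
  qed
  then obtain t where N: "N = Suc t" by (cases N) auto
  have notS: "\<not> S \<subseteq> ?F t" using T(2)[of t] \<open>N \<le> T\<close> N by simp
  obtain r x z where o: "explore I (AdSub m (?h t)) = (r, x, z)" by (metis prod_cases3)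
  have cost: "cost (AdSub m) I = x + 2 * (\<Sum>(r, x, z)\<leftarrow>?h t. x)"
    unfolding cost_def N_def[symmetric] using reached o by (auto simp: N)
  show ?thesis
  \<comment> \<open>If the last trip completes \<open>S\<close>, its one-way length
    \<open>d r\<close> supplies the 1 in \<open>phi = 1 + 2 * growth\<close>, and the earlier trips
    the rest.\<close>
  proof (cases "S \<subseteq> ?F N")
    case True
    have z: "z \<noteq> None" "?F N = insert r (?F t)"
      using notS True o unfolding N by (auto simp: found_rays_Cons split: if_splits)
    have r: "r \<in> S" "r \<notin> ?F t" "S - ?F t = {r}" using True notS z by auto
    have x: "x = ereal (d r)"
      using o z d(1)[OF r(1)] unfolding explore_def by (auto split: prod.splits if_splits)
    from trips[OF r(1,2)] obtain A where A: "(\<Sum>(r, x, z)\<leftarrow>?h t. x) = ereal A"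
      "A \<le> growth (m - 1 - card (S \<inter> ?F t)) * d r + (1 + exp 1) * sum d (S \<inter> ?F t)" by blast
    show ?thesis
    proof (rule that[of "S \<inter> ?F t" r])
      show "cost (AdSub m) I \<le> ereal (phi (real (m - 1 - card (S \<inter> ?F t))) * d r
          + (2 + 2 * exp 1) * sum d (S \<inter> ?F t))"
        unfolding cost A(1) x phi_eq_growth using A(2) by (simp add: algebra_simps)
    next
      fix k assume "k \<in> S - S \<inter> ?F t"
      then show "d r \<le> d k" using r by auto
    qed (use r in auto)
  next
    case False
    then obtain i where i: "i \<in> S - ?F N" "\<And>k. k \<in> S - ?F N \<Longrightarrow> d i \<le> d k"
      using least[OF False] by blast
    have iN: "i \<in> S" "i \<notin> ?F N" using i(1) by auto
    from trips[OF this] obtain B where B: "(\<Sum>(r, x, z)\<leftarrow>?h N. x) = ereal B"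
      "B \<le> growth (m - 1 - card (S \<inter> ?F N)) * d i + (1 + exp 1) * sum d (S \<inter> ?F N)" by blast
    have "i \<notin> ?F t" using iN found_rays_run_mono[of "AdSub m" I t] unfolding N by blast
    from trips[OF iN(1) this] obtain A where A: "(\<Sum>(r, x, z)\<leftarrow>?h t. x) = ereal A" by blast
    have x: "x = ereal (B - A)" 
      using A B(1) o unfolding N by (cases x) auto
    show ?thesis
    proof (rule that[of "S \<inter> ?F N" i])
      \<comment> \<open>\<open>B\<close> counts every trip once and \<open>A\<close> all but the
        last. As \<open>i\<close> is missing even after the last trip, \<open>B\<close> itself is
        bounded, and the cost is at most \<open>2 * B\<close>.\<close>
      have "cost (AdSub m) I = ereal (B + A)" unfolding cost A(1) x by simp
      also have "A \<le> B"
      proof -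
        have "i < m" "distance I i < \<infinity>" using i S by auto
        from AdSub_run_move[OF I(1) this \<open>i \<notin> ?F t\<close>] obtain j l
          where "AdSub m (?h t) = (j, l)" "j < m" "0 \<le> l" by metis
        moreover have "0 \<le> distance I j" using ge_1(1) \<open>j < m\<close> order_trans[of 0 1 "distance I j"] by simp
        ultimately have "0 \<le> x"
          using o by (auto simp: explore_def split: if_splits)
        then show ?thesis using x by simp
      qed
      then have "ereal (B + A) \<le> ereal (2 * B)" by simp
      also have "\<dots> \<le> ereal (phi (real (m - 1 - card (S \<inter> ?F N))) * d i
          + (2 + 2 * exp 1) * sum d (S \<inter> ?F N))"
        unfolding phi_eq_growth using B(2) d(2)[of i] i(1) by (simp add: algebra_simps)
      finally show "cost (AdSub m) I \<le> \<dots>" .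
    qed (use i in auto)
  qed
qed

section \<open>Comparison with the optimal set\<close>

lemma finite_feasible: "finite (feasible m I)"
  by (rule finite_subset[of _ "Pow {..<m}"]) (auto simp: feasible_def)

lemma feasible_nonempty: "I \<in> instances m \<Longrightarrow> feasible m I \<noteq> {}"
  by (auto simp: instances_def feasible_def set_weight_def)

lemma optimal_set:
  assumes "I \<in> instances m"
  obtains S where "S \<in> feasible m I" "set_dist I S = opt m I" "card S = opt_size m I"
proof -
  let ?O = "{S \<in> feasible m I. set_dist I S = opt m I}"
  have "opt m I \<in> set_dist I ` feasible m I"
    unfolding opt_def using finite_feasible feasible_nonempty[OF assms] by (intro Min_in) auto
  then have "card ` ?O \<noteq> {}" by auto
  moreover have "finite (card ` ?O)" using finite_feasible[of m I] by simp
  ultimately have "opt_size m I \<in> card ` ?O" unfolding opt_size_def by (rule Max_in[rotated])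
  then show ?thesis using that by auto
qed

lemma set_dist_finite:
  assumes "finite S" "S \<noteq> {}" "\<And>j. j \<in> S \<Longrightarrow> distance I j = ereal (d j)"
  shows "set_dist I S = ereal (2 * sum d S - Max (d ` S))"
proof -
  have "distance I ` S = ereal ` d ` S" using assms(3) by (auto simp: image_iff)
  moreover have "ereal (Max (d ` S)) = Max (ereal ` d ` S)"
    using assms(1,2) by (intro mono_Max_commute) (auto simp: mono_def)
  moreover have "(\<Sum>i\<in>S. distance I i) = ereal (sum d S)" using assms(3) by simp
  ultimately have "set_dist I S = 2 * ereal (sum d S) - ereal (Max (d ` S))"
    using assms(2) by (simp only: set_dist_def if_False)
  then show ?thesis by simp
qed

lemma set_dist_infinite:
  assumes "finite S" "j \<in> S" "distance I j = \<infinity>"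
  shows "set_dist I S = \<infinity>"
proof -
  have "(\<Sum>i\<in>S. distance I i) = \<infinity>" using assms by (auto simp: sum_Pinfty)
  then show ?thesis using assms(2) by (auto simp: set_dist_def)
qed

text \<open>Subtracting the maximum removes one copy of one distance. If it lies in
  \<open>Y\<close>, one copy of \<open>sum d Y\<close> survives and the missing rays keep both
  copies; otherwise one missing ray loses a copy.\<close>

lemma set_dist_ge:
  fixes d :: "nat \<Rightarrow> real"
  assumes "finite S" "Y \<subseteq> S" "i \<in> S - Y" "\<And>k. k \<in> S - Y \<Longrightarrow> d i \<le> d k" "\<And>k. k \<in> S \<Longrightarrow> 0 \<le> d k"
  shows "sum d Y + (2 * real (card (S - Y) - 1) + 1) * d i \<le> 2 * sum d S - Max (d ` S)"
proof -
  let ?c = "real (card (S - Y))"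
  have "card (S - Y) \<noteq> 0" using assms(1,3) by auto
  then have c: "real (card (S - Y) - 1) = ?c - 1" by (simp add: of_nat_diff)
  have Y: "sum d S = sum d Y + sum d (S - Y)"
    using sum.subset_diff[OF assms(2,1), of d] by simp
  have T: "?c * d i \<le> sum d (S - Y)" using sum_bounded_below[of "S - Y" "d i" d] assms(4) by auto
  have "0 \<le> d i" "0 \<le> sum d Y" using assms by (auto intro!: sum_nonneg)
  have "Max (d ` S) \<in> d ` S" using assms(1,3) by (intro Max_in) auto
  then obtain q where q: "q \<in> S" "Max (d ` S) = d q" by auto
  show ?thesis
  proof (cases "q \<in> Y")
    case True
    then have "d q \<le> sum d Y"
      using assms finite_subset[OF assms(2,1)] by (intro member_le_sum) auto
    then show ?thesis unfolding c q(2) Y using T \<open>0 \<le> d i\<close> by (simp add: algebra_simps)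
  next
    case False
    then have q': "q \<in> S - Y" using q by auto
    have "real (card (S - Y - {q})) * d i \<le> sum d (S - Y - {q})"
      using sum_bounded_below[of "S - Y - {q}" "d i" d] assms(4) by auto
    moreover have "sum d (S - Y) = d q + sum d (S - Y - {q})"
      using q' assms(1) by (simp add: sum.remove)
    moreover have "real (card (S - Y - {q})) = ?c - 1"
      using q' assms(1) c by simp
    ultimately show ?thesis unfolding c q(2) Y using T \<open>0 \<le> sum d Y\<close> by (simp add: algebra_simps)
  qed
qed

text \<open>The two conditions on \<open>c\<close> compare cost and optimum separately on the found
  part \<open>Y\<close> and on the \<open>u + 1\<close> missing rays, split as in
  \<open>set_dist_ge\<close>; there \<open>m - 1 - card Y = m - s + u\<close>.\<close>

lemma cost_AdSch_le:
  assumes I: "I \<in> instances m" and "opt_size m I = s"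
    and c: "2 + 2 * exp 1 \<le> c" "\<And>u. phi (real (m - s + u)) \<le> (2 * real u + 1) * c"
  shows "cost (AdSch m) I \<le> ereal c * opt m I"
proof -
  obtain S where S: "S \<in> feasible m I" "set_dist I S = opt m I" "card S = s"
    using optimal_set[OF I] assms(2) by metis
  have c_pos: "0 < c" using c(1) exp_gt_zero[of "1::real"] by linarith
  have Sm: "S \<subseteq> {..<m}" "threshold I \<le> set_weight I S" using S(1) by (auto simp: feasible_def)
  have fin: "finite S" using Sm(1) finite_subset by blast
  define d where "d = (\<lambda>j. real_of_ereal (distance I j))"
  have ge_1: "1 \<le> distance I j" if "j \<in> S" for j using that I Sm(1) by (auto simp: instances_def)
  show ?thesis
  proof (cases "\<exists>j\<in>S. distance I j = \<infinity>")
    case True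
    then have "opt m I = \<infinity>" using set_dist_infinite[OF fin] S(2) by metis
    then show ?thesis using c_pos by simp
  next
    case False
    have d: "distance I j = ereal (d j)" "1 \<le> d j" if "j \<in> S" for j
    proof -
      have "\<bar>distance I j\<bar> \<noteq> \<infinity>" using ge_1[OF that] False that by auto
      then show "distance I j = ereal (d j)" unfolding d_def by (simp add: ereal_real)
      then show "1 \<le> d j" using ge_1[OF that] by (metis ereal_less_eq(3) one_ereal_def)
    qed
    show ?thesis
    proof (cases "threshold I \<le> 0")
      case True
      then have 0: "threshold I \<le> found_weight (run (AdSch m) I 0)" by (simp add: found_weight_def)
      then have "(LEAST n. threshold I \<le> found_weight (run (AdSch m) I n)) = 0" by simp
      moreover have "\<exists>n. threshold I \<le> found_weight (run (AdSch m) I n)" using 0 by blast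
      ultimately have "cost (AdSch m) I = 0" by (simp add: cost_def)
      moreover have "0 \<le> opt m I"
      proof (cases "S = {}")
        case True
        then show ?thesis using S(2) by (simp add: set_dist_def)
      next
        case False
        have "Max (d ` S) \<in> d ` S" using fin False by (intro Max_in) auto
        then obtain q where q: "q \<in> S" "Max (d ` S) = d q" by auto
        have nn: "\<And>j. j \<in> S \<Longrightarrow> 0 \<le> d j" using d(2) by force
        then have "d q \<le> sum d S" using q(1) fin by (intro member_le_sum) auto
        moreover have "0 \<le> sum d S" using nn by (intro sum_nonneg) auto
        moreover have "opt m I = ereal (2 * sum d S - Max (d ` S))"
          using set_dist_finite[OF fin False d(1)] S(2) by simp
        ultimately show ?thesis using q(2) by simp
      qed
      ultimately show ?thesis using c_pos by (simp add: ereal_0_le_mult)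
    next
      case False
      then have pos: "0 < threshold I" by simp
      have below: "\<And>j. j \<in> S \<Longrightarrow> distance I j < \<infinity>" using d(1) by simp
      show ?thesis
      proof (rule cost_AdSub_le[OF I pos Sm below])
        fix Y i
        assume "Y \<subseteq> S" "i \<in> S - Y"
          and "\<And>k. k \<in> S - Y \<Longrightarrow> real_of_ereal (distance I i) \<le> real_of_ereal (distance I k)"
          and "cost (AdSub m) I \<le> ereal (phi (real (m - 1 - card Y)) * real_of_ereal (distance I i)
            + (2 + 2 * exp 1) * (\<Sum>j\<in>Y. real_of_ereal (distance I j)))"
        then have Y: "Y \<subseteq> S" "i \<in> S - Y" "\<And>k. k \<in> S - Y \<Longrightarrow> d i \<le> d k"
          "cost (AdSub m) I \<le> ereal (phi (real (m - 1 - card Y)) * d i + (2 + 2 * exp 1) * sum d Y)"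
          by (auto simp: d_def)
      have nonneg: "\<And>k. k \<in> S \<Longrightarrow> 0 \<le> d k" using d(2) by force
      let ?u = "card (S - Y) - 1"
      have "finite Y" using Y(1) fin finite_subset by blast
      then have "card (S - Y) = s - card Y" "card Y \<le> s"
        using card_Diff_subset[OF _ Y(1)] card_mono[OF fin Y(1)] S(3) by auto
      moreover have "card (S - Y) \<noteq> 0" using Y(2) fin by auto
      moreover have "s \<le> m" using card_mono[OF _ Sm(1)] S(3) by simp
      ultimately have "m - 1 - card Y = m - s + ?u" by linarith
      then have "phi (real (m - 1 - card Y)) * d i \<le> (2 * real ?u + 1) * c * d i"
        using c(2)[of ?u] nonneg[of i] Y(2) by (metis DiffD1 mult_right_mono)
      moreover have "(2 + 2 * exp 1) * sum d Y \<le> c * sum d Y"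
        using c(1) nonneg Y(1) by (intro mult_right_mono sum_nonneg) auto
      ultimately have "phi (real (m - 1 - card Y)) * d i + (2 + 2 * exp 1) * sum d Y
          \<le> c * (sum d Y + (2 * real ?u + 1) * d i)"
        by (simp add: algebra_simps)
      also have "\<dots> \<le> c * (2 * sum d S - Max (d ` S))"
        using set_dist_ge[of S Y i d] fin Y nonneg c_pos by (intro mult_left_mono) auto
      finally have "cost (AdSub m) I \<le> ereal (c * (2 * sum d S - Max (d ` S)))"
        using Y(4) by (meson ereal_less_eq(3) order_trans)
      moreover have "S \<noteq> {}" using Y(2) by auto
      then have "opt m I = ereal (2 * sum d S - Max (d ` S))"
        using set_dist_finite[OF fin _ d(1)] S(2) by simp
      ultimately show ?thesis by (simp add: AdSch_def)
      qed
    qed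
  qed
qed

lemma AdSch_upper:
  assumes "I \<in> instances m"
  shows "opt_size m I < m \<Longrightarrow>
      cost (AdSch m) I \<le> ereal (phi (real m - real (opt_size m I))) * opt m I"
    and "opt_size m I = m \<Longrightarrow> cost (AdSch m) I \<le> ereal (3 + 2 * exp 1) * opt m I"
proof -
  have e3: "exp 1 \<le> (3::real)" by (rule exp_le)
  {
    assume "opt_size m I < m"
    then have n: "1 \<le> m - opt_size m I" "real m - real (opt_size m I) = real (m - opt_size m I)"
      by auto
    show "cost (AdSch m) I \<le> ereal (phi (real m - real (opt_size m I))) * opt m I"
      unfolding n(2)
    proof (rule cost_AdSch_le[OF assms refl])
      show "2 + 2 * exp 1 \<le> phi (real (m - opt_size m I))"
        using phi_ge_9[OF n(1)] e3 by linarith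
    qed (use phi_scale[OF n(1)] in simp)
  }
  {
    assume s: "opt_size m I = m"
    show "cost (AdSch m) I \<le> ereal (3 + 2 * exp 1) * opt m I"
    proof (rule cost_AdSch_le[OF assms s])
      fix u
      \<comment> \<open>Here \<open>m - s = 0\<close>, outside the range of
        \<open>phi_scale\<close>, so the exponential bound is used directly.\<close>
      have "phi (real u) \<le> 1 + 2 * ((real u + 1) * exp 1)"
        using growth_upper[of u] by (simp add: phi_eq_growth)
      also have "\<dots> \<le> (2 * real u + 1) * (3 + 2 * exp 1)"
      proof -
        have "0 \<le> real u * exp 1" by simp
        then show ?thesis by (simp add: algebra_simps)
      qed
      finally show "phi (real (m - m + u)) \<le> (2 * real u + 1) * (3 + 2 * exp 1)" by simp
    qed simp
  }
qed

section \<open>Depths in increasing order\<close>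

text \<open>The \<open>k\<close> largest among \<open>k\<close> zeros and the first \<open>n\<close> terms of \<open>x\<close>, in increasing order.\<close>

primrec top_list :: "nat \<Rightarrow> (nat \<Rightarrow> real) \<Rightarrow> nat \<Rightarrow> real list" where
  "top_list k x 0 = replicate k 0"
| "top_list k x (Suc n) = tl (insort (x n) (top_list k x n))"

lemma length_top_list [simp]: "length (top_list k x n) = k"
  by (induction n) auto

lemma sorted_top_list: "sorted (top_list k x n)"
  by (induction n) (auto simp: sorted_replicate sorted_insort intro: sorted_tl)

lemma top_list_nonneg:
  assumes "\<And>n. 0 \<le> x n"
  shows "r \<in> set (top_list k x n) \<Longrightarrow> 0 \<le> r"
proof (induction n arbitrary: r)
  case (Suc n)
  have "r \<in> set (insort (x n) (top_list k x n))" using Suc.prems by (auto dest: list.set_sel(2)[rotated])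
  then show ?case using Suc.IH assms by (auto simp: set_insort_key)
qed (auto split: if_splits)

lemma insort_nth_le: "sorted t \<Longrightarrow> j < length t \<Longrightarrow> insort (x::real) t ! j \<le> t ! j"
proof (induction t arbitrary: j)
  case (Cons y t)
  show ?case
  proof (cases j)
    case (Suc i)
    have "(y # t) ! i \<le> (y # t) ! Suc i"
      using Cons.prems Suc by (intro sorted_nth_mono) auto
    then show ?thesis using Cons Suc by simp
  qed simp
qed simp

lemma sum_lessThan_add: "(\<Sum>j<n + i. f j) = (\<Sum>j<n. f j) + (\<Sum>j<i. f (n + j))"
  for f :: "nat \<Rightarrow> real"
  by (induction i) (auto simp: add.assoc)

text \<open>Insertion raises no entry at a fixed position, and dropping the head moves every entry
  down by one position.\<close>

lemma top_list_shift: "i + j < k \<Longrightarrow> top_list k x (n + i) ! j \<le> top_list k x n ! (i + j)"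
proof (induction i arbitrary: j)
  case (Suc i)
  have "top_list k x (n + Suc i) ! j = insort (x (n + i)) (top_list k x (n + i)) ! Suc j"
    using Suc.prems by (simp add: nth_tl)
  also have "\<dots> \<le> top_list k x (n + i) ! Suc j"
    using Suc.prems by (intro insort_nth_le sorted_top_list) auto
  also have "\<dots> \<le> top_list k x n ! (i + Suc j)" using Suc by (intro Suc.IH) auto
  finally show ?case by simp
qed auto

lemma top_list_skip:
  assumes "x n \<le> hd (top_list k x n)"
  shows "top_list k x (Suc n) = top_list k x n"
proof -
  have "\<forall>y\<in>set (top_list k x n). x n \<le> y"
    using assms sorted_top_list[of k x n] by (cases "top_list k x n") auto
  then show ?thesis by (simp add: insort_is_Cons)
qed

lemma top_list_push:
  assumes "hd (top_list k x n) < x n" "0 < k"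
  shows "sum_list (top_list k x (Suc n)) = sum_list (top_list k x n) + x n - hd (top_list k x n)"
proof -
  obtain y t where t: "top_list k x n = y # t"
    using assms(2) length_top_list[of k x n] by (cases "top_list k x n") auto
  have "sum_list (insort z u) = z + sum_list u" for z :: real and u
    by (induction u) auto
  then show ?thesis using t assms(1) by simp
qed

lemma hd_top_list_mono: "0 < k \<Longrightarrow> hd (top_list k x n) \<le> hd (top_list k x (Suc n))"
proof -
  assume k: "0 < k"
  obtain y t where t: "top_list k x n = y # t"
    using k length_top_list[of k x n] by (cases "top_list k x n") auto
  show ?thesis
  proof (cases "x n \<le> y")
    case True
    then show ?thesis using top_list_skip[of x n k] t by simp
  next
    case False
    then have s: "top_list k x (Suc n) = insort (x n) t" using t by simp
    have "insort (x n) t \<noteq> []" by (cases t) auto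
    then have "hd (insort (x n) t) \<in> insert (x n) (set t)" by (metis hd_in_set set_insort_key)
    then show ?thesis unfolding s t using sorted_top_list[of k x n] t False by auto
  qed
qed

text \<open>Each term enters the list and displaces its head, so the terms sum to the displaced
  heads plus the current list. By \<open>top_list_shift\<close> the current list dominates the next
  \<open>k\<close> heads, which causes the delay in the recurrence.\<close>

lemma top_list_prefix_sum:
  assumes push: "\<And>n. hd (top_list k x n) < x n" and k: "0 < k"
  shows "(\<Sum>j<n + k. hd (top_list k x j)) \<le> (\<Sum>j<n. x j)"
proof -
  have "(\<Sum>j<n. x j) = (\<Sum>j<n. hd (top_list k x j)) + sum_list (top_list k x n)"
    by (induction n) (auto simp: sum_list_replicate top_list_push[OF push k] simp del: top_list.simps(2))
  moreover have "(\<Sum>j<k. hd (top_list k x (n + j))) \<le> sum_list (top_list k x n)"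
  proof -
    have "top_list k x (n + j) \<noteq> []" for j using k by (metis length_top_list less_numeral_extra(3) list.size(3))
    then have "hd (top_list k x (n + j)) \<le> top_list k x n ! j" if "j < k" for j
      using top_list_shift[of j 0 k x n] that by (simp add: hd_conv_nth)
    then show ?thesis by (subst sum_list_sum_nth) (auto simp: atLeast0LessThan intro!: sum_mono)
  qed
  ultimately show ?thesis by (simp add: sum_lessThan_add)
qed

text \<open>Terms that do not exceed the head leave the list unchanged and can be skipped.
  Infinitely many others remain because the head is unbounded.\<close>

lemma top_list_events:
  fixes x :: "nat \<Rightarrow> real"
  assumes k: "0 < k" and x: "\<And>n. 0 \<le> x n" and unbounded: "\<And>B. \<exists>n. B < hd (top_list k x n)"
  obtains \<tau> where "strict_mono \<tau>" "\<And>i. hd (top_list k (x \<circ> \<tau>) i) < x (\<tau> i)"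
    "\<And>i. top_list k (x \<circ> \<tau>) i = top_list k x (\<tau> i)"
proof -
  define E where "E = {n. hd (top_list k x n) < x n}"
  have skip: "top_list k x b = top_list k x a" if "a \<le> b" "\<And>n. a \<le> n \<Longrightarrow> n < b \<Longrightarrow> n \<notin> E" for a b
    using that
  proof (induction b rule: dec_induct)
    case (step b)
    have "b \<notin> E" using step by auto
    then have "x b \<le> hd (top_list k x b)" by (simp add: E_def not_less)
    then have "top_list k x (Suc b) = top_list k x b" by (rule top_list_skip)
    moreover have "top_list k x b = top_list k x a" by (rule step.IH) (simp add: step.prems)
    ultimately show ?case by (rule trans)
  qed (rule refl)
  have inf: "infinite E"
  proof
    assume "finite E"
    then obtain a where a: "\<And>n. n \<in> E \<Longrightarrow> n < a" unfolding finite_nat_set_iff_bounded by auto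
    obtain n where n: "hd (top_list k x a) < hd (top_list k x n)" using unbounded ..
    have mono: "mono (\<lambda>n. hd (top_list k x n))"
      using hd_top_list_mono[OF k] by (simp add: mono_iff_le_Suc del: top_list.simps(2))
    have "a \<le> n"
    proof (rule ccontr)
      assume "\<not> a \<le> n"
      then have "hd (top_list k x n) \<le> hd (top_list k x a)" using monoD[OF mono, of n a] by simp
      then show False using n by simp
    qed
    then have "top_list k x n = top_list k x a" by (rule skip) (use a in force)
    then show False using n by simp
  qed
  define \<tau> where "\<tau> = enumerate E"
  have mem: "\<tau> i \<in> E" for i using inf by (simp add: \<tau>_def enumerate_in_set)
  have eq: "top_list k (x \<circ> \<tau>) i = top_list k x (\<tau> i)" for i
  proof (induction i)
    case 0
    have "n \<notin> E" if "n < \<tau> 0" for n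
      using that not_less_Least[of n "\<lambda>n. n \<in> E"] by (simp add: \<tau>_def enumerate_0)
    then show ?case using skip[of 0 "\<tau> 0"] by simp
  next
    case (Suc i)
    have lt: "\<tau> i < \<tau> (Suc i)" unfolding \<tau>_def using inf by (rule enumerate_step)
    have "n \<notin> E" if "\<tau> i < n" "n < \<tau> (Suc i)" for n
      using that not_less_Least[of n "\<lambda>n. n \<in> E \<and> \<tau> i < n"] enumerate_Suc''[OF inf, of i]
      by (auto simp: \<tau>_def)
    then have "top_list k x (\<tau> (Suc i)) = top_list k x (Suc (\<tau> i))"
      using lt by (intro skip) auto
    then show ?case using Suc by simp
  qed
  show ?thesis
  proof (rule that)
    show "strict_mono \<tau>" unfolding \<tau>_def using inf by (rule strict_mono_enumerate)
    show "hd (top_list k (x \<circ> \<tau>) i) < x (\<tau> i)" for i using mem[of i] by (simp add: eq E_def)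
  qed (rule eq)
qed

section \<open>The delayed recurrence\<close>

text \<open>The left side is the tangent of \<open>L ^ Suc n\<close> at \<open>L = base n\<close>,
  and Bernoulli's inequality expresses convexity.\<close>

lemma growth_tangent:
  assumes "1 \<le> n" "0 \<le> L"
  shows "growth n * (L - 1) \<le> L ^ Suc n"
proof -
  let ?b = "base (real n)"
  have b: "1 \<le> ?b" "real n * ?b = real n + 1" using assms(1) by (auto simp: base_def field_simps)
  have "1 + real (Suc n) * (L / ?b - 1) \<le> (1 + (L / ?b - 1)) ^ Suc n"
    using assms(2) b by (intro Bernoulli_inequality) (auto intro: divide_nonneg_nonneg)
  then have "?b ^ Suc n * (1 + real (Suc n) * (L / ?b - 1)) \<le> ?b ^ Suc n * (L / ?b) ^ Suc n"
    using b by (intro mult_left_mono) auto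
  also have "?b ^ Suc n * (L / ?b) ^ Suc n = L ^ Suc n"
    using b by (simp flip: power_mult_distrib)
  also have "?b ^ Suc n * (1 + real (Suc n) * (L / ?b - 1))
      = ?b ^ n * (real (Suc n) * L - real n * ?b)"
    using b(1) by (simp add: field_simps)
  finally show ?thesis by (simp add: b(2) growth_def algebra_simps)
qed

text \<open>The partial sums grow by a factor that can be improved indefinitely: a factor \<open>L\<close> yields
  \<open>1 + L\<^sup>k / \<mu>\<close>, which exceeds \<open>L\<close> by a constant, by the tangent inequality.\<close>

lemma delayed_sum_contradiction:
  fixes a :: "nat \<Rightarrow> real"
  assumes a: "mono a" "\<And>n. 0 \<le> a n" "\<And>B. \<exists>n. B < a n"
    and n: "1 \<le> n" and \<mu>: "0 < \<mu>" "\<mu> < growth n" and C: "0 \<le> C"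
    and sum: "\<And>i. (\<Sum>j<i + Suc n. a j) \<le> \<mu> * a i + C"
  shows False
proof -
  define S where "S = (\<lambda>i. \<Sum>j<i. a j)"
  have S_Suc: "S (Suc i) = S i + a i" for i by (simp add: S_def)
  have S_mono: "mono S" by (rule monoI) (auto simp: S_def a intro: sum_mono2)
  have S_unbounded: "\<exists>N. \<forall>i\<ge>N. B \<le> S i" for B
  proof -
    obtain N where "B < a N" using a(3) by blast
    moreover have "0 \<le> S N" using a(2) by (simp add: S_def sum_nonneg)
    ultimately have "B \<le> S (Suc N)" using S_Suc[of N] by linarith
    then show ?thesis using monoD[OF S_mono] by (meson order_trans)
  qed
  \<comment> \<open>Half of the slack between \<open>1 / \<mu>\<close> and
    \<open>1 / growth n\<close>. The other half absorbs \<open>C\<close>, which is at most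
    \<open>\<mu> * \<kappa> * S i\<close> once \<open>S i\<close> is large.\<close>
  define \<kappa> where "\<kappa> = (1 / \<mu> - 1 / growth n) / 2"
  have \<kappa>: "0 < \<kappa>" using \<mu> by (simp add: \<kappa>_def field_simps)
  obtain N where N: "\<And>i. N \<le> i \<Longrightarrow> max 1 (C / (\<mu> * \<kappa>)) \<le> S i" using S_unbounded by blast
  have "\<exists>M\<ge>N. \<forall>i\<ge>M. (1 + real l * \<kappa>) * S i \<le> S (Suc i)" for l
  proof (induction l)
    case 0
    then show ?case using monoD[OF S_mono] by auto
  next
    case (Suc l)
    let ?L = "1 + real l * \<kappa>"
    obtain M where M: "N \<le> M" "\<And>i. M \<le> i \<Longrightarrow> ?L * S i \<le> S (Suc i)" using Suc by blast
    have L: "1 \<le> ?L" using \<kappa> by simp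
    have "(1 + real (Suc l) * \<kappa>) * S i \<le> S (Suc i)" if i: "M \<le> i" for i
    proof -
      have Si: "1 \<le> S i" "C \<le> \<mu> * \<kappa> * S i"
        using N[of i] M(1) i \<mu> \<kappa> by (auto simp: divide_le_eq mult_ac)
      have pow: "?L ^ p * S i \<le> S (i + p)" for p
      proof (induction p)
        case (Suc p)
        have "?L * (?L ^ p * S i) \<le> ?L * S (i + p)" using Suc L by (intro mult_left_mono) auto
        also have "\<dots> \<le> S (Suc (i + p))" using i by (intro M(2)) auto
        finally show ?case by (simp add: mult.assoc)
      qed simp
      have "?L ^ Suc n * S i \<le> \<mu> * a i + C"
        using pow[of "Suc n"] sum[of i] unfolding S_def by linarith
      then have "?L ^ Suc n * S i \<le> \<mu> * (a i + \<kappa> * S i)"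
        using Si(2) by (simp add: algebra_simps)
      then have 1: "?L ^ Suc n / \<mu> * S i \<le> a i + \<kappa> * S i"
        using \<mu>(1) by (simp add: field_simps)
      have "?L - 1 \<le> ?L ^ Suc n / growth n"
        using growth_tangent[OF n, of ?L] L \<mu> by (simp add: field_simps)
      moreover have "1 * (2 * \<kappa>) \<le> ?L ^ Suc n * (2 * \<kappa>)"
        using L \<kappa> one_le_power[OF L, of "Suc n"] by (intro mult_right_mono) auto
      moreover have "?L ^ Suc n * (2 * \<kappa>) = ?L ^ Suc n / \<mu> - ?L ^ Suc n / growth n"
      proof -
        have "2 * \<kappa> = 1 / \<mu> - 1 / growth n" by (simp add: \<kappa>_def)
        then show ?thesis by (simp only: right_diff_distrib times_divide_eq_right mult_1_right)
      qed
      ultimately have "?L - 1 + 2 * \<kappa> \<le> ?L ^ Suc n / \<mu>" by linarith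
      then have "(?L - 1 + 2 * \<kappa>) * S i \<le> ?L ^ Suc n / \<mu> * S i"
        using Si(1) by (intro mult_right_mono) auto
      with 1 show ?thesis unfolding S_Suc by (simp add: algebra_simps)
    qed
    then show ?case using M(1) by blast
  qed
  \<comment> \<open>A factor above \<open>\<mu> + 1\<close> is impossible:
    \<open>S (i + 2) \<le> \<mu> * a i + C\<close>, and both \<open>a i\<close> and eventually
    \<open>C\<close> are at most \<open>S (i + 1)\<close>.\<close>
  moreover obtain l where l: "\<mu> + 1 < 1 + real l * \<kappa>"
    using reals_Archimedean3[OF \<kappa>] by (metis add.commute add_less_cancel_left)
  ultimately obtain M where M: "N \<le> M" "\<And>i. M \<le> i \<Longrightarrow> (1 + real l * \<kappa>) * S i \<le> S (Suc i)" by blast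
  obtain N' where N': "\<And>i. N' \<le> i \<Longrightarrow> C \<le> S i" using S_unbounded by blast
  define i where "i = max M N'"
  have Si: "1 \<le> S (Suc i)" "C \<le> S (Suc i)" using N[of "Suc i"] N'[of "Suc i"] M(1) by (auto simp: i_def)
  have "(1 + real l * \<kappa>) * S (Suc i) \<le> S (Suc (Suc i))" by (rule M(2)) (simp add: i_def)
  also have "\<dots> \<le> S (i + Suc n)" using n by (intro monoD[OF S_mono]) auto
  also have "\<dots> \<le> \<mu> * a i + C" using sum[of i] by (simp add: S_def)
  also have "\<dots> \<le> \<mu> * S (Suc i) + S (Suc i)"
  proof -
    have "a i \<le> S (Suc i)" using a(2) S_Suc[of i] by (simp add: S_def sum_nonneg)
    then show ?thesis using \<mu>(1) Si(2) by (intro add_mono mult_left_mono) auto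
  qed
  finally have "(1 + real l * \<kappa>) * S (Suc i) \<le> (\<mu> + 1) * S (Suc i)" by (simp add: algebra_simps)
  moreover have "(\<mu> + 1) * S (Suc i) < (1 + real l * \<kappa>) * S (Suc i)"
    using l Si(1) by (intro mult_strict_right_mono) auto
  ultimately show False by linarith
qed

text \<open>Passing to the terms that displace the head keeps the lists and only lowers the sum of
  terms, so the heads satisfy the delayed recurrence.\<close>

lemma trip_sequence_contradiction:
  fixes x :: "nat \<Rightarrow> real"
  assumes n: "1 \<le> n" and x: "\<And>j. 0 \<le> x j" and \<mu>: "0 < \<mu>" "\<mu> < growth n" and C: "0 \<le> C"
    and unbounded: "\<And>B. \<exists>i. B < hd (top_list (Suc n) x i)"
    and sum: "\<And>i. (\<Sum>j<i. x j) \<le> \<mu> * hd (top_list (Suc n) x i) + C"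
  shows False
proof -
  obtain \<tau> where \<tau>: "strict_mono \<tau>" "\<And>i. hd (top_list (Suc n) (x \<circ> \<tau>) i) < x (\<tau> i)"
    "\<And>i. top_list (Suc n) (x \<circ> \<tau>) i = top_list (Suc n) x (\<tau> i)"
    using top_list_events[of "Suc n" x] x unbounded by auto
  define a where "a = (\<lambda>i. hd (top_list (Suc n) (x \<circ> \<tau>) i))"
  show False
  proof (rule delayed_sum_contradiction[of a n \<mu> C])
    show mono: "mono a" unfolding a_def mono_iff_le_Suc using hd_top_list_mono by blast
    show "0 \<le> a i" for i
      unfolding a_def using top_list_nonneg[of "x \<circ> \<tau>" _ "Suc n" i] x
      by (metis comp_apply hd_in_set length_top_list list.size(3) nat.distinct(1))
    show "\<exists>i. B < a i" for B
    proof -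
      obtain i where "B < hd (top_list (Suc n) x i)" using unbounded by blast
      also have "\<dots> \<le> hd (top_list (Suc n) x (\<tau> i))"
      proof -
        have "mono (\<lambda>i. hd (top_list (Suc n) x i))"
          unfolding mono_iff_le_Suc using hd_top_list_mono by blast
        then show ?thesis using strict_mono_imp_increasing[OF \<tau>(1), of i] by (rule monoD)
      qed
      finally show ?thesis by (auto simp: a_def \<tau>(3))
    qed
    show "(\<Sum>j<i + Suc n. a j) \<le> \<mu> * a i + C" for i
    proof -
      have "(\<Sum>j<i + Suc n. a j) \<le> (\<Sum>j<i. (x \<circ> \<tau>) j)"
        unfolding a_def by (rule top_list_prefix_sum) (use \<tau>(2) in auto)
      also have "\<dots> = sum x (\<tau> ` {..<i})"
        using \<tau>(1) by (simp add: sum.reindex strict_mono_imp_inj_on)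
      also have "\<dots> \<le> (\<Sum>j<\<tau> i. x j)"
        using \<tau>(1) x by (intro sum_mono2) (auto simp: strict_mono_less)
      also have "\<dots> \<le> \<mu> * a i + C" using sum by (simp add: a_def \<tau>(3))
      finally show ?thesis .
    qed
  qed (use n \<mu> C in auto)
qed

section \<open>Adversarial instances\<close>

definition unit_instance :: "real \<Rightarrow> (nat \<Rightarrow> ereal) \<Rightarrow> star_instance" where
  "unit_instance W d = \<lparr>threshold = W, distance = d, weight = (\<lambda>_. 1)\<rparr>"

lemma unit_instance_simps [simp]:
  "threshold (unit_instance W d) = W" "distance (unit_instance W d) = d"
  "weight (unit_instance W d) j = 1"
  by (simp_all add: unit_instance_def)

lemma unit_instance_mem:
  "\<lbrakk>\<And>j. j < m \<Longrightarrow> 1 \<le> d j; s \<le> m\<rbrakk> \<Longrightarrow> unit_instance (real s) d \<in> instances m"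
  by (simp add: instances_def)

lemma feasible_unit_instance:
  "feasible m (unit_instance (real s) d) = {S. S \<subseteq> {..<m} \<and> s \<le> card S}"
  by (simp add: feasible_def set_weight_def)

text \<open>There are just as many targets as needed: any other feasible set contains a ray without
  a target and has infinite distance.\<close>

lemma opt_unit_instance:
  assumes "T \<subseteq> {..<m}" "\<And>j. j < m \<Longrightarrow> j \<notin> T \<Longrightarrow> d j = \<infinity>" "\<And>j. j \<in> T \<Longrightarrow> d j = ereal (\<delta> j)" "T \<noteq> {}"
  defines "I \<equiv> unit_instance (real (card T)) d"
  shows "opt m I = ereal (2 * sum \<delta> T - Max (\<delta> ` T))" "opt_size m I = card T"
proof -
  have fin: "finite T" using assms(1) finite_subset by blast
  have T: "set_dist I T = ereal (2 * sum \<delta> T - Max (\<delta> ` T))"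
    using fin assms(3,4) by (intro set_dist_finite) (auto simp: I_def)
  have feas: "T \<in> feasible m I" using assms(1) by (simp add: I_def feasible_unit_instance)
  have other: "set_dist I S = \<infinity>" if S: "S \<in> feasible m I" "S \<noteq> T" for S
  proof -
    have "S \<subseteq> {..<m}" "card T \<le> card S" using S(1) by (auto simp: I_def feasible_unit_instance)
    then have "\<not> S \<subseteq> T" using S(2) fin card_seteq by blast
    then obtain j where "j \<in> S" "j \<notin> T" by blast
    then show ?thesis
      using assms(2) \<open>S \<subseteq> {..<m}\<close> finite_subset by (intro set_dist_infinite[of S j]) (auto simp: I_def)
  qed
  have opt: "opt m I = set_dist I T" unfolding opt_def
  proof (rule Min_eqI)
    fix y assume "y \<in> set_dist I ` feasible m I"
    then show "set_dist I T \<le> y" using other by fastforce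
  qed (use feas finite_feasible in auto)
  then show "opt m I = ereal (2 * sum \<delta> T - Max (\<delta> ` T))" using T by simp
  have "set_dist I S \<noteq> opt m I" if "S \<in> feasible m I" "S \<noteq> T" for S
    using other[OF that] opt T by simp
  then have "{S \<in> feasible m I. set_dist I S = opt m I} = {T}" using feas opt by auto
  then show "opt_size m I = card T" by (simp add: opt_size_def)
qed

abbreviation trips :: "history \<Rightarrow> ereal" where
  "trips h \<equiv> (\<Sum>(r, x, z)\<leftarrow>h. x)"

lemma finite_found_rays: "finite (found_rays h)"
proof -
  have "found_rays h \<subseteq> fst ` set h" by (force simp: found_rays_def)
  then show ?thesis by (rule finite_subset) simp
qed

text \<open>The guarantees of \<open>search_strategy\<close> hold below the threshold only. Since
  found rays are never revisited, unit weights make the found weight a count of rays.\<close>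

lemma run_valid:
  assumes \<Sigma>: "search_strategy m \<Sigma>" and I: "I \<in> instances m" "\<And>j. weight I j = 1"
    and "\<And>k. k < n \<Longrightarrow> found_weight (run \<Sigma> I k) < threshold I"
  shows "(\<forall>(r, x, z)\<in>set (run \<Sigma> I n). r < m \<and> 0 \<le> x \<and> (z \<noteq> None \<longrightarrow> x = distance I r \<and> x < \<infinity>))
    \<and> found_weight (run \<Sigma> I n) = real (card (found_rays (run \<Sigma> I n)))"
  using assms(4)
proof (induction n)
  case 0
  have "found_rays [] = {}" by (simp add: found_rays_def)
  then show ?case by (simp add: found_weight_def)
next
  case (Suc n)
  let ?h = "run \<Sigma> I n"
  obtain r l where m: "\<Sigma> ?h = (r, l)" by fastforce
  have "found_weight ?h < threshold I" using Suc.prems by simp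
  then have r: "r < m" "r \<notin> found_rays ?h" "0 \<le> l" using \<Sigma> I(1) m by (force simp: search_strategy_def)+
  have "1 \<le> distance I r" using I(1) r(1) by (auto simp: instances_def)
  then have d: "0 \<le> distance I r" using order_trans[of 0 1 "distance I r"] by simp
  have IH: "\<forall>(r, x, z)\<in>set ?h. r < m \<and> 0 \<le> x \<and> (z \<noteq> None \<longrightarrow> x = distance I r \<and> x < \<infinity>)"
    "found_weight ?h = real (card (found_rays ?h))" using Suc by auto
  show ?case
  proof (cases "distance I r \<le> l \<and> distance I r < \<infinity>")
    case True
    then have step: "run \<Sigma> I (Suc n) = (r, distance I r, Some 1) # ?h" using m I(2) by (simp add: explore_def)
    show ?thesis unfolding step using IH r True d finite_found_rays[of ?h]
      by (simp add: found_rays_Cons found_weight_def)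
  next
    case False
    then have step: "run \<Sigma> I (Suc n) = (r, l, None) # ?h" using m by (auto simp: explore_def)
    show ?thesis unfolding step using IH r by (simp add: found_rays_Cons found_weight_def)
  qed
qed

lemma run_cong:
  assumes "\<And>k. k < n \<Longrightarrow> explore I (\<Sigma> (run \<Sigma> J k)) = explore J (\<Sigma> (run \<Sigma> J k))"
  shows "run \<Sigma> I n = run \<Sigma> J n"
  using assms by (induction n) auto

lemma run_extends: "n \<le> N \<Longrightarrow> \<exists>xs. run \<Sigma> I N = xs @ run \<Sigma> I n"
proof (induction N rule: dec_induct)
  case (step N)
  then obtain xs where "run \<Sigma> I N = xs @ run \<Sigma> I n" by blast
  then have "run \<Sigma> I (Suc N) = (explore I (\<Sigma> (run \<Sigma> I N)) # xs) @ run \<Sigma> I n" by simp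
  then show ?case by blast
qed simp

lemma trips_nonneg: "\<forall>(r, x, z)\<in>set h. 0 \<le> x \<Longrightarrow> 0 \<le> trips h"
  by (intro sum_list_nonneg) auto

lemma sum_le_trips:
  fixes \<delta> :: "nat \<Rightarrow> real"
  assumes "\<forall>(r, x, z)\<in>set h. 0 \<le> x" "finite U" "\<And>j. j \<in> U \<Longrightarrow> \<exists>w. (j, ereal (\<delta> j), Some w) \<in> set h"
  shows "ereal (sum \<delta> U) \<le> trips h"
  using assms
proof (induction h arbitrary: U)
  case Nil
  then have "U = {}" by auto
  then show ?case by (simp add: zero_ereal_def)
next
  case (Cons a h)
  obtain r x z where a: "a = (r, x, z)" by (metis prod_cases3)
  have nn: "0 \<le> x" using Cons.prems(1) a by simp
  show ?case
  proof (cases "r \<in> U \<and> x = ereal (\<delta> r)")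
    case True
    have "\<exists>w. (j, ereal (\<delta> j), Some w) \<in> set h" if "j \<in> U - {r}" for j
      using Cons.prems(3)[of j] that a by auto
    then have "ereal (sum \<delta> (U - {r})) \<le> trips h" using Cons.prems by (intro Cons.IH) auto
    moreover have "sum \<delta> U = \<delta> r + sum \<delta> (U - {r})" using True Cons.prems(2) by (simp add: sum.remove)
    then have "ereal (sum \<delta> U) = x + ereal (sum \<delta> (U - {r}))" using True by simp
    ultimately show ?thesis by (simp add: a add_left_mono)
  next
    case False
    have "\<exists>w. (j, ereal (\<delta> j), Some w) \<in> set h" if "j \<in> U" for j
      using Cons.prems(3)[OF that] that False a by auto
    then have "ereal (sum \<delta> U) \<le> trips h" using Cons.prems by (intro Cons.IH) auto
    then show ?thesis using nn by (simp add: a add_increasing)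
  qed
qed

text \<open>The head of \<open>xs\<close> is the final trip and counts once. At best it is the find
  of the farthest ray in \<open>U\<close>; every other find counts twice.\<close>

lemma travelled_ge:
  fixes \<delta> :: "nat \<Rightarrow> real"
  assumes "\<forall>(r, x, z)\<in>set (xs @ h). 0 \<le> x" and U: "finite U" "U \<noteq> {}" "\<And>j. j \<in> U \<Longrightarrow> 0 \<le> \<delta> j"
    and mem: "\<And>j. j \<in> U \<Longrightarrow> \<exists>w. (j, ereal (\<delta> j), Some w) \<in> set xs"
  shows "ereal (2 * sum \<delta> U - Max (\<delta> ` U)) + 2 * trips h \<le> travelled (xs @ h)"
proof -
  obtain j where "j \<in> U" using U(2) by auto
  then obtain a ys where xs: "xs = a # ys" using mem[of j] by (cases xs) auto
  obtain r x z where a: "a = (r, x, z)" by (metis prod_cases3)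
  have all: "0 \<le> x" "\<forall>(r, x, z)\<in>set ys. 0 \<le> x" "\<forall>(r, x, z)\<in>set h. 0 \<le> x"
    using assms(1) a xs by auto
  note nn = all(1,2) trips_nonneg[OF all(2)] trips_nonneg[OF all(3)]
  have trav: "travelled (xs @ h) = x + 2 * trips ys + 2 * trips h"
    using nn by (simp add: xs a ereal_right_distrib add.assoc)
  have "ereal (2 * sum \<delta> U - Max (\<delta> ` U)) \<le> x + 2 * trips ys"
  proof (cases "r \<in> U \<and> x = ereal (\<delta> r)")
    case True
    have "\<exists>w. (j, ereal (\<delta> j), Some w) \<in> set ys" if "j \<in> U - {r}" for j
      using mem[of j] that a xs by auto
    then have "ereal (sum \<delta> (U - {r})) \<le> trips ys" using nn U by (intro sum_le_trips) auto
    then have "2 * ereal (sum \<delta> (U - {r})) \<le> 2 * trips ys" by (intro ereal_mult_left_mono) auto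
    then have "x + 2 * ereal (sum \<delta> (U - {r})) \<le> x + 2 * trips ys" by (rule add_left_mono)
    moreover have "sum \<delta> U = \<delta> r + sum \<delta> (U - {r})" using True U(1) by (simp add: sum.remove)
    moreover have "\<delta> r \<le> Max (\<delta> ` U)" using True U(1) by auto
    ultimately show ?thesis using True by (auto intro: order_trans[rotated])
  next
    case False
    have "\<exists>w. (j, ereal (\<delta> j), Some w) \<in> set ys" if "j \<in> U" for j
      using mem[OF that] that False a xs by auto
    then have "ereal (sum \<delta> U) \<le> trips ys" using nn U by (intro sum_le_trips) auto
    then have "2 * ereal (sum \<delta> U) \<le> 2 * trips ys" by (intro ereal_mult_left_mono) auto
    then have "2 * ereal (sum \<delta> U) \<le> x + 2 * trips ys" using nn(1) by (simp add: add_increasing)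
    moreover have "0 \<le> Max (\<delta> ` U)" using U \<open>j \<in> U\<close> by (auto simp: Max_ge_iff)
    ultimately show ?thesis by (auto intro: order_trans[rotated])
  qed
  then show ?thesis unfolding trav by (rule add_right_mono)
qed

text \<open>All targets are needed, so the rays of \<open>U\<close> must still be found after the
  first \<open>n\<close> trips, each of which is then paid both ways.\<close>

lemma cost_unit_instance_ge:
  fixes \<delta> :: "nat \<Rightarrow> real"
  assumes \<Sigma>: "search_strategy m \<Sigma>"
    and T: "T \<subseteq> {..<m}" "\<And>j. j < m \<Longrightarrow> j \<notin> T \<Longrightarrow> d j = \<infinity>"
      "\<And>j. j \<in> T \<Longrightarrow> d j = ereal (\<delta> j) \<and> 1 \<le> \<delta> j"
    and U: "U \<subseteq> T" "U \<noteq> {}" "U \<inter> found_rays (run \<Sigma> (unit_instance (real (card T)) d) n) = {}"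
  shows "ereal (2 * sum \<delta> U - Max (\<delta> ` U)) + 2 * trips (run \<Sigma> (unit_instance (real (card T)) d) n)
    \<le> cost \<Sigma> (unit_instance (real (card T)) d)"
proof -
  let ?I = "unit_instance (real (card T)) d"
  let ?h = "run \<Sigma> ?I"
  have fin: "finite T" using T(1) finite_subset by blast
  have "1 \<le> d j" if "j < m" for j using T(2,3)[of j] that by (cases "j \<in> T") auto
  moreover have "card T \<le> m" using card_mono[OF _ T(1)] by simp
  ultimately have I: "?I \<in> instances m" by (rule unit_instance_mem)
  show ?thesis
  proof (cases "\<exists>n. threshold ?I \<le> found_weight (?h n)")
    case False
    then show ?thesis by (simp add: cost_def)
  next
    case True
    define N where "N = (LEAST n. threshold ?I \<le> found_weight (?h n))"
    have N: "threshold ?I \<le> found_weight (?h N)" unfolding N_def using True by (rule LeastI_ex)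
    have before: "found_weight (?h k) < threshold ?I" if "k < N" for k
      using not_less_Least[OF that[unfolded N_def]] by simp
    note valid = run_valid[OF \<Sigma> I _ before]
    have sub: "found_rays (?h N) \<subseteq> T"
    proof
      fix r assume "r \<in> found_rays (?h N)"
      then obtain x w where "(r, x, Some w) \<in> set (?h N)" by (auto simp: found_rays_def)
      then have "r < m" "d r < \<infinity>" using valid by fastforce+
      then show "r \<in> T" using T(2)[of r] by auto
    qed
    have "real (card T) \<le> real (card (found_rays (?h N)))" using N valid by simp
    then have found: "found_rays (?h N) = T" using card_seteq[OF fin sub] by simp
    have "n < N"
    proof (rule ccontr)
      assume "\<not> n < N"
      then obtain xs where "?h n = xs @ ?h N" using run_extends[of N n] by (metis not_less)
      then have "found_rays (?h N) \<subseteq> found_rays (?h n)" by (auto simp: found_rays_def)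
      then show False using found U by blast
    qed
    then obtain xs where xs: "?h N = xs @ ?h n" using run_extends[of n N] by (metis less_imp_le)
    have "\<exists>w. (j, ereal (\<delta> j), Some w) \<in> set xs" if "j \<in> U" for j
    proof -
      have "j \<in> found_rays (?h N)" "j \<notin> found_rays (?h n)" using found U that by auto
      then obtain x w where *: "(j, x, Some w) \<in> set xs" "(j, x, Some w) \<in> set (?h N)"
        unfolding xs by (auto simp: found_rays_def)
      then have "x = d j" using valid by fastforce
      moreover have "d j = ereal (\<delta> j)" using T(3)[of j] U(1) that by auto
      ultimately show ?thesis using *(1) by auto
    qed
    moreover have "\<forall>(r, x, z)\<in>set (xs @ ?h n). 0 \<le> x" unfolding xs[symmetric] using valid by fastforce
    moreover have "0 \<le> \<delta> j" if "j \<in> U" for j using T(3)[of j] U(1) that by force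
    ultimately have "ereal (2 * sum \<delta> U - Max (\<delta> ` U)) + 2 * trips (?h n) \<le> travelled (xs @ ?h n)"
      using finite_subset[OF U(1) fin] U(2) by (intro travelled_ge) auto
    moreover have "cost \<Sigma> ?I = travelled (?h N)" unfolding cost_def N_def using True by simp
    ultimately show ?thesis by (simp only: xs)
  qed
qed

lemma cost_unreached:
  "(\<And>n. found_weight (run \<Sigma> I n) < threshold I) \<Longrightarrow> cost \<Sigma> I = \<infinity>"
  unfolding cost_def by (metis not_le)

section \<open>The adversary for \<open>s < m\<close>\<close>

text \<open>The condition on \<open>v\<close> keeps the initial zeros of the list out of the
  count.\<close>

lemma length_filter_top_list:
  assumes "0 \<le> v"
  shows "length (filter (\<lambda>y. v < y) (top_list k x n)) = min k (card {j. j < n \<and> v < x j})"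
proof (induction n)
  case 0
  then show ?case using assms by simp
next
  case (Suc n)
  let ?t = "top_list k x n" and ?P = "\<lambda>y. v < y"
  obtain y w where u: "insort (x n) ?t = y # w" by (cases "insort (x n) ?t") auto
  have "sorted (y # w)" unfolding u[symmetric] by (simp add: sorted_insort sorted_top_list)
  have "length w = k" using arg_cong[OF u, of length] by simp
  have "length (filter ?P (insort a t)) = (if v < a then 1 else 0) + length (filter ?P t)" for a :: real and t
    by (induction t) auto
  then have fu: "length (filter ?P (y # w)) = (if v < x n then 1 else 0) + length (filter ?P ?t)"
    unfolding u[symmetric] .
  have "length (filter ?P w) = min k (length (filter ?P (y # w)))"
  proof (cases "v < y")
    case True
    then have "filter ?P w = w" using \<open>sorted (y # w)\<close> by (auto simp: filter_id_conv)
    then show ?thesis using True \<open>length w = k\<close> by simp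
  next
    case False
    then show ?thesis using length_filter_le[of ?P w] \<open>length w = k\<close> by simp
  qed
  moreover have "{j. j < Suc n \<and> v < x j} = (if v < x n then insert n {j. j < n \<and> v < x j} else {j. j < n \<and> v < x j})"
    by (auto simp: less_Suc_eq)
  ultimately show ?case using Suc fu u by (auto simp: min_def split: if_splits)
qed

text \<open>Fewer than \<open>k\<close> trips exceed the head of the list, so by counting, some ray
  of \<open>R\<close> received none of them.\<close>

lemma least_explored_ray:
  assumes "\<And>j. 0 \<le> x j" "finite R" "card R = k" "0 < k"
  obtains r where "r \<in> R" "\<And>j. j < n \<Longrightarrow> \<rho> j = r \<Longrightarrow> x j \<le> hd (top_list k x n)"
proof -
  let ?t = "top_list k x n"
  let ?J = "{j. j < n \<and> hd ?t < x j}"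
  have hd: "hd ?t \<in> set ?t" using assms(4) by (metis hd_in_set length_top_list less_numeral_extra(3) list.size(3))
  then have "0 \<le> hd ?t" by (rule top_list_nonneg[OF assms(1)])
  have "length (filter (\<lambda>y. hd ?t < y) ?t) < length ?t" using hd by (rule length_filter_less) simp
  then have "card ?J < k" using length_filter_top_list[OF \<open>0 \<le> hd ?t\<close>, of k x n] by simp
  moreover have "card (\<rho> ` ?J) \<le> card ?J" by (rule card_image_le) simp
  ultimately have "\<not> R \<subseteq> \<rho> ` ?J" using assms(3) card_mono[of "\<rho> ` ?J" R] by fastforce
  then obtain r where "r \<in> R" "r \<notin> \<rho> ` ?J" by blast
  then show ?thesis by (intro that[of r]) (auto simp: not_less[symmetric])
qed

text \<open>If the ratio stays below \<open>phi - \<epsilon>\<close> on all instances, every prefix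
  of trips is bounded by the depth of the least explored far ray, and
  \<open>trip_sequence_contradiction\<close> applies. The tolerance provides the strict gap below
  \<open>growth\<close>.\<close>

lemma lower_bound_partial:
  assumes \<Sigma>: "search_strategy m \<Sigma>" and s: "1 \<le> s" "s < m" and \<epsilon>: "0 < \<epsilon>"
  shows "\<exists>I\<in>instances m. opt_size m I = s
    \<and> ereal (phi (real m - real (opt_size m I)) - \<epsilon>) * opt m I \<le> cost \<Sigma> I"
proof (rule ccontr)
  assume contr: "\<not> ?thesis"
  \<comment> \<open>Here \<open>k\<close> is \<open>m - s\<close>, one less than the number of far
    rays, so that the ratio is \<open>phi k\<close>.\<close>
  define k where "k = m - s"
  have k: "1 \<le> k" "real m - real s = real k" "Suc k = m - (s - 1)" using s by (auto simp: k_def)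
  define c where "c = phi (real k) - \<epsilon>"
  define R where "R = {s - 1..<m}"
  have R: "finite R" "card R = Suc k" using k s by (auto simp: R_def)
  define dist where "dist = (\<lambda>r d j. if j < s - 1 then 1 else if j = r then ereal d else \<infinity>)"
  define I where "I = (\<lambda>r d. unit_instance (real s) (dist r d))"
  \<comment> \<open>The reference instance lacks the last target. Its threshold is never reached, so
    the moves stay admissible forever, and \<open>I r d\<close> looks the same until ray
    \<open>r\<close> is explored to depth \<open>d\<close>.\<close>
  define J where "J = unit_instance (real s) (\<lambda>j. if j < s - 1 then 1 else \<infinity>)"
  define h where "h = run \<Sigma> J"
  define \<rho> where "\<rho> = (\<lambda>n. fst (\<Sigma> (h n)))"
  define l where "l = (\<lambda>n. snd (\<Sigma> (h n)))"
  have move: "\<Sigma> (h n) = (\<rho> n, l n)" for n by (simp add: \<rho>_def l_def)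

  have J: "J \<in> instances m" unfolding J_def using s by (intro unit_instance_mem) auto
  have J_simps: "threshold J = real s" "weight J j = 1"
    "distance J j = (if j < s - 1 then 1 else \<infinity>)" for j by (simp_all add: J_def)
  have h_found: "found_weight (h n) < real s" for n
  proof (induction n rule: less_induct)
    case (less n)
    have valid: "(\<forall>(r, x, z)\<in>set (h n). r < m \<and> 0 \<le> x \<and> (z \<noteq> None \<longrightarrow> x = distance J r \<and> x < \<infinity>))
      \<and> found_weight (h n) = real (card (found_rays (h n)))"
      unfolding h_def using less J_simps by (intro run_valid[OF \<Sigma> J]) (auto simp: h_def)
    have "found_rays (h n) \<subseteq> {..<s - 1}"
    proof
      fix r assume "r \<in> found_rays (h n)"
      then obtain x w where "(r, x, Some w) \<in> set (h n)" by (auto simp: found_rays_def)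
      then have "distance J r < \<infinity>" using valid by fastforce
      then show "r \<in> {..<s - 1}" by (auto simp: J_simps split: if_splits)
    qed
    then have "card (found_rays (h n)) \<le> s - 1" using card_mono[of "{..<s - 1}"] by fastforce
    then show ?case using valid s by simp
  qed
  have valid: "\<forall>(r, x, z)\<in>set (h n). r < m \<and> 0 \<le> x \<and> (z \<noteq> None \<longrightarrow> x = distance J r \<and> x < \<infinity>)" for n
    using run_valid[OF \<Sigma> J, of n] h_found by (simp add: J_simps h_def)
  have l_nonneg: "0 \<le> l n" and \<rho>_less: "\<rho> n < m" for n
    using \<Sigma> J h_found[of n] move[of n] by (force simp: search_strategy_def h_def J_simps)+
  have near: "r \<notin> R" if found: "r \<in> found_rays (h n)" for r n
  proof -
    obtain x w where "(r, x, Some w) \<in> set (h n)" using found by (auto simp: found_rays_def)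
    then have "distance J r < \<infinity>" using valid[of n] by fastforce
    then show ?thesis by (auto simp: J_simps R_def split: if_splits)
  qed

  have agree: "run \<Sigma> (I r d) n = h n"
    if "r \<in> R" "\<And>j. j < n \<Longrightarrow> \<rho> j = r \<Longrightarrow> l j < ereal d" for r d n
    unfolding h_def
  proof (rule run_cong)
    fix j assume "j < n"
    then have "\<not> ereal d \<le> l j" if "\<rho> j = r" using that \<open>\<And>j. _ \<Longrightarrow> _ \<Longrightarrow> l j < ereal d\<close>[of j] by (simp add: not_le)
    then show "explore (I r d) (\<Sigma> (run \<Sigma> J j)) = explore J (\<Sigma> (run \<Sigma> J j))"
      using move[of j] by (auto simp: explore_def h_def I_def dist_def J_def)
  qed
  have cost_I: "cost \<Sigma> (I r d) < ereal (c * (2 * real (s - 1) + d))"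
      "\<And>n. r \<notin> found_rays (run \<Sigma> (I r d) n) \<Longrightarrow>
        ereal d + 2 * trips (run \<Sigma> (I r d) n) \<le> cost \<Sigma> (I r d)"
    if r: "r \<in> R" and d: "1 \<le> d" for r d
  proof -
    define \<delta> where "\<delta> = (\<lambda>j. if j < s - 1 then 1 else d)"
    define T where "T = insert r {..<s - 1}"
    have T: "T \<subseteq> {..<m}" "card T = s" "T \<noteq> {}" using r s by (auto simp: T_def R_def)
    have fin: "finite T" by (simp add: T_def)
    have I: "I r d = unit_instance (real (card T)) (dist r d)" by (simp add: I_def T)
    have \<delta>: "dist r d j = ereal (\<delta> j) \<and> 1 \<le> \<delta> j" if "j \<in> T" for j
      using that d by (auto simp: dist_def \<delta>_def T_def one_ereal_def)
    have out: "dist r d j = \<infinity>" if "j \<notin> T" for j using that by (auto simp: dist_def T_def)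
    have "sum \<delta> T = real (s - 1) + d" using r by (simp add: T_def \<delta>_def R_def)
    moreover have "Max (\<delta> ` T) = d"
      using r d fin by (intro Max_eqI) (auto simp: \<delta>_def T_def R_def)
    ultimately have opt: "opt m (I r d) = ereal (2 * real (s - 1) + d)" "opt_size m (I r d) = s"
      using opt_unit_instance[of T m "dist r d" \<delta>] T out \<delta> by (simp_all add: I)
    have "1 \<le> dist r d j" for j using d by (simp add: dist_def one_ereal_def)
    then have "I r d \<in> instances m" unfolding I_def using s by (intro unit_instance_mem) auto
    with contr opt show "cost \<Sigma> (I r d) < ereal (c * (2 * real (s - 1) + d))"
      by (auto simp: k(2) c_def not_le)
    fix n assume "r \<notin> found_rays (run \<Sigma> (I r d) n)"
    then have "ereal (2 * sum \<delta> {r} - Max (\<delta> ` {r})) + 2 * trips (run \<Sigma> (I r d) n) \<le> cost \<Sigma> (I r d)"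
      unfolding I using out \<delta>
      by (intro cost_unit_instance_ge[OF \<Sigma> T(1)]) (auto simp: T_def)
    then show "ereal d + 2 * trips (run \<Sigma> (I r d) n) \<le> cost \<Sigma> (I r d)"
      using r by (simp add: \<delta>_def R_def)
  qed
  \<comment> \<open>Hiding the last target on \<open>r\<close> where it is still unexplored leaves
    the first \<open>n\<close> trips unchanged; the assumed ratio then limits their length.\<close>
  have far: "ereal d + 2 * trips (h n) < ereal (c * (2 * real (s - 1) + d))"
    if r: "r \<in> R" and d: "1 \<le> d" and unseen: "\<And>j. j < n \<Longrightarrow> \<rho> j = r \<Longrightarrow> l j < ereal d" for r d n
  proof -
    have "run \<Sigma> (I r d) n = h n" using r unseen by (rule agree)
    then have "ereal d + 2 * trips (h n) \<le> cost \<Sigma> (I r d)"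
      using cost_I(2)[OF r d, of n] near[of r n] r by auto
    then show ?thesis using cost_I(1)[OF r d] by (rule le_less_trans)
  qed

  have trips_Suc: "trips (h (Suc n)) = fst (snd (explore J (\<rho> n, l n))) + trips (h n)" for n
    using move[of n] by (simp add: h_def split_beta)
  have trips_h: "0 \<le> trips (h n)" for n using valid[of n] by (intro trips_nonneg) auto
  \<comment> \<open>An infinite trip on one far ray would make the cost infinite for a target on
    another one, placed beyond all depths so far. A second far ray exists since
    \<open>k \<ge> 1\<close>.\<close>
  have finite_far: "\<rho> n \<in> R \<Longrightarrow> l n < \<infinity>" for n
  proof (induction n rule: less_induct)
    case (less n)
    have "\<exists>r\<in>R. r \<noteq> \<rho> n"
    proof (rule ccontr)
      assume "\<not> ?thesis"
      then have "R \<subseteq> {\<rho> n}" by auto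
      then show False using card_mono[of "{\<rho> n}" R] R k by simp
    qed
    then obtain r where r: "r \<in> R" "r \<noteq> \<rho> n" by blast
    define d where "d = 1 + (\<Sum>j<n. real_of_ereal (l j))"
    have nn: "0 \<le> real_of_ereal (l j)" for j using l_nonneg by (rule real_of_ereal_pos)
    then have "1 \<le> d" by (simp add: d_def sum_nonneg)
    have unseen: "l j < ereal d" if "j < Suc n" "\<rho> j = r" for j
    proof -
      have j: "j < n" using that r by (auto simp: less_Suc_eq)
      then have "l j < \<infinity>" using less.IH[of j] that r by auto
      then have "l j = ereal (real_of_ereal (l j))" using l_nonneg[of j] by (cases "l j") auto
      moreover have "real_of_ereal (l j) \<le> (\<Sum>j<n. real_of_ereal (l j))"
        using j nn by (intro member_le_sum) auto
      then have "real_of_ereal (l j) < d" by (simp add: d_def)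
      ultimately show ?thesis by (metis ereal_less_eq(3) linorder_not_le)
    qed
    have "ereal d + 2 * trips (h (Suc n)) < ereal (c * (2 * real (s - 1) + d))"
      using unseen by (rule far[OF r(1) \<open>1 \<le> d\<close>])
    then have "trips (h (Suc n)) \<noteq> \<infinity>" by auto
    moreover have "explore J (\<rho> n, l n) = (\<rho> n, l n, None)"
      using less.prems by (auto simp: explore_def J_simps R_def)
    ultimately show ?case using trips_Suc[of n] trips_h[of n] by auto
  qed

  \<comment> \<open>Trips to near rays enter as 0, which keeps the indices and only lowers the
    sum.\<close>
  define x where "x = (\<lambda>n. if \<rho> n \<in> R then real_of_ereal (l n) else 0)"
  have x_nonneg: "0 \<le> x n" for n using l_nonneg[of n] by (simp add: x_def real_of_ereal_pos)
  have lx: "l n = ereal (x n)" if "\<rho> n \<in> R" for n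
    using finite_far[OF that] l_nonneg[of n] that by (cases "l n") (auto simp: x_def)
  have sum_x: "ereal (\<Sum>j<n. x j) \<le> trips (h n)" for n
  proof (induction n)
    case 0
    then show ?case by (simp add: h_def zero_ereal_def)
  next
    case (Suc n)
    have "ereal (x n) \<le> fst (snd (explore J (\<rho> n, l n)))"
      using lx[of n] l_nonneg[of n] \<rho>_less[of n]
      by (auto simp: explore_def J_simps R_def x_def zero_ereal_def[symmetric])
    from add_mono[OF this Suc] show ?case unfolding trips_Suc by (simp add: add.commute)
  qed
  define v where "v = (\<lambda>n. hd (top_list (Suc k) x n))"
  have v_nonneg: "0 \<le> v n" for n
    unfolding v_def using top_list_nonneg[of x _ "Suc k" n, OF x_nonneg]
    by (metis hd_in_set length_top_list list.size(3) nat.distinct(1))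
  have least: "\<exists>r\<in>R. \<forall>j<n. \<rho> j = r \<longrightarrow> x j \<le> v n" for n
  proof (rule least_explored_ray[OF x_nonneg R zero_less_Suc])
    fix r assume "r \<in> R" "\<And>j. j < n \<Longrightarrow> \<rho> j = r \<Longrightarrow> x j \<le> hd (top_list (Suc k) x n)"
    then show ?thesis by (auto simp: v_def)
  qed

  \<comment> \<open>The first entry gives \<open>c - 1 \<le> 2 * \<mu>\<close>; the second keeps
    \<open>\<mu>\<close> positive when \<open>\<epsilon>\<close> is large.\<close>
  define \<mu> where "\<mu> = max (growth k - \<epsilon> / 2) (growth k / 2)"
  have \<mu>: "0 < \<mu>" "\<mu> < growth k" using growth_pos[of k] \<epsilon> by (auto simp: \<mu>_def)
  show False
  \<comment> \<open>The additive constant collects the offset 1 of a target at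
    \<open>v n + 1\<close> and the share of the near targets in the optimum.\<close>
  proof (rule trip_sequence_contradiction[of k x \<mu> "\<mu> + \<bar>c\<bar> * real (s - 1)"])
    fix n
    obtain r where r: "r \<in> R" "\<And>j. j < n \<Longrightarrow> \<rho> j = r \<Longrightarrow> x j \<le> v n" using least[of n] by blast
    have "l j < ereal (v n + 1)" if "j < n" "\<rho> j = r" for j
      using r(2)[OF that] lx[of j] that r(1) by simp
    then have "ereal (v n + 1) + 2 * trips (h n) < ereal (c * (2 * real (s - 1) + (v n + 1)))"
      using v_nonneg[of n] r(1) by (intro far[of r]) auto
    moreover have "ereal (v n + 1) + 2 * ereal (\<Sum>j<n. x j) \<le> ereal (v n + 1) + 2 * trips (h n)"
      using sum_x[of n] by (intro add_left_mono ereal_mult_left_mono) auto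
    ultimately have "ereal (v n + 1) + 2 * ereal (\<Sum>j<n. x j) < ereal (c * (2 * real (s - 1) + (v n + 1)))"
      by (rule le_less_trans[rotated])
    then have "2 * (\<Sum>j<n. x j) < (c - 1) * (v n + 1) + 2 * (c * real (s - 1))"
      by (simp add: algebra_simps)
    also have "(c - 1) * (v n + 1) \<le> 2 * \<mu> * (v n + 1)"
    proof (rule mult_right_mono)
      have "growth k - \<epsilon> / 2 \<le> \<mu>" by (simp add: \<mu>_def)
      then show "c - 1 \<le> 2 * \<mu>" by (simp add: c_def phi_eq_growth)
    qed (use v_nonneg[of n] in simp)
    also have "c * real (s - 1) \<le> \<bar>c\<bar> * real (s - 1)" by (intro mult_right_mono) auto
    finally show "(\<Sum>j<n. x j) \<le> \<mu> * hd (top_list (Suc k) x n) + (\<mu> + \<bar>c\<bar> * real (s - 1))"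
      by (simp add: algebra_simps v_def)
  next
    fix B
    show "\<exists>i. B < hd (top_list (Suc k) x i)"
    proof (rule ccontr)
      assume "\<nexists>i. B < hd (top_list (Suc k) x i)"
      then have bounded: "\<nexists>i. B < v i" by (simp add: v_def)
      \<comment> \<open>Each far ray must eventually be explored to depth \<open>d\<close>, as
        otherwise a target there would never be found. After finitely many trips all are, so the
        least explored depth exceeds \<open>B\<close>.\<close>
      define d where "d = \<bar>B\<bar> + 1"
      have seen: "\<exists>j. \<rho> j = r \<and> ereal d \<le> l j" if r: "r \<in> R" for r
      proof (rule ccontr)
        assume "\<nexists>j. \<rho> j = r \<and> ereal d \<le> l j"
        then have unseen: "\<rho> j = r \<Longrightarrow> l j < ereal d" for j by (auto simp: not_le)
        then have "run \<Sigma> (I r d) n = h n" for n using agree[OF r] by blast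
        then have "cost \<Sigma> (I r d) = \<infinity>" using h_found by (intro cost_unreached) (simp add: I_def)
        then show False using cost_I(1)[OF r, of d] by (simp add: d_def)
      qed
      then obtain f where f: "\<And>r. r \<in> R \<Longrightarrow> \<rho> (f r) = r \<and> ereal d \<le> l (f r)" by metis
      define n where "n = Suc (Max (f ` R))"
      have n: "f r < n" if "r \<in> R" for r using that R(1) by (simp add: n_def less_Suc_eq_le)
      obtain r where r: "r \<in> R" "\<forall>j<n. \<rho> j = r \<longrightarrow> x j \<le> v n" using least by blast
      then have "x (f r) \<le> v n" using f n by blast
      also have "v n \<le> B" using bounded by (simp add: not_less)
      finally have "x (f r) < d" unfolding d_def by linarith
      moreover have "\<rho> (f r) \<in> R" using f[OF r(1)] r(1) by simp
      ultimately have "l (f r) < ereal d" using lx[of "f r"] by simp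
      then show False using f[OF r(1)] by (simp add: leD)
    qed
  qed (use k \<mu> x_nonneg in auto)
qed

section \<open>The adversary for \<open>s = m\<close>\<close>

text \<open>Without \<open>finite_depths\<close>, the instance with no targets serves: optimum and
  cost are both infinite. Otherwise the targets are placed according to the depths chosen on that
  instance, at finite distances.\<close>

lemma lower_bound_full:
  assumes m: "2 \<le> m" and \<Sigma>: "search_strategy m \<Sigma>"
  shows "\<exists>I\<in>instances m. opt_size m I = m \<and> 2 * opt m I \<le> cost \<Sigma> I
    \<and> (finite_depths m \<Sigma> \<longrightarrow> opt m I < \<infinity>)"
proof -
  define J where "J = unit_instance (real m) (\<lambda>_. \<infinity>)"
  define h where "h = run \<Sigma> J"
  have J: "J \<in> instances m" unfolding J_def by (intro unit_instance_mem) auto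
  have "explore J a = (fst a, snd a, None)" for a by (cases a) (simp add: explore_def J_def)
  then have J_explore: "explore J (\<Sigma> (h n)) = (fst (\<Sigma> (h n)), snd (\<Sigma> (h n)), None)" for n .
  have "found_rays [] = {}" by (simp add: found_rays_def)
  then have h_found: "found_weight (h n) = 0 \<and> found_rays (h n) = {}" for n
  proof (induction n)
    case (Suc n)
    have "h (Suc n) = (fst (\<Sigma> (h n)), snd (\<Sigma> (h n)), None) # h n"
      using J_explore[of n] by (simp add: h_def)
    then show ?case using Suc by (simp add: found_weight_def found_rays_Cons)
  qed (simp add: h_def found_weight_def)
  show ?thesis
  proof (cases "finite_depths m \<Sigma>")
    case False
    have "feasible m J = {{..<m}}"
    proof -
      have "S = {..<m}" if "S \<subseteq> {..<m}" "m \<le> card S" for S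
        using card_seteq[OF _ that(1)] that(2) by simp
      then show ?thesis unfolding J_def feasible_unit_instance by auto
    qed
    moreover have "set_dist J {..<m} = \<infinity>"
      using m by (intro set_dist_infinite[of _ 0]) (auto simp: J_def)
    ultimately have "opt m J = \<infinity>" "opt_size m J = m" by (simp_all add: opt_def opt_size_def)
    moreover have "cost \<Sigma> J = \<infinity>"
      using h_found m by (intro cost_unreached) (simp add: J_def h_def)
    ultimately show ?thesis using J False by (intro bexI[of _ J]) auto
  next
    case True
    define \<rho> where "\<rho> = (\<lambda>n. fst (\<Sigma> (h n)))"
    define x where "x = (\<lambda>n. real_of_ereal (snd (\<Sigma> (h n))))"
    have move: "\<Sigma> (h n) = (\<rho> n, ereal (x n))" and valid: "\<rho> n < m" "0 \<le> x n" for n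
    proof -
      have "found_weight (run \<Sigma> J n) < threshold J" using h_found[of n] m by (simp add: h_def J_def)
      moreover have "2 \<le> card ({..<m} - found_rays (run \<Sigma> J n))"
        using h_found[of n] m by (simp add: h_def)
      ultimately have "snd (\<Sigma> (h n)) < \<infinity>" "fst (\<Sigma> (h n)) < m" "0 \<le> snd (\<Sigma> (h n))"
        using True \<Sigma> J unfolding finite_depths_def search_strategy_def h_def
        by (auto simp: case_prod_beta)
      then show "\<Sigma> (h n) = (\<rho> n, ereal (x n))" "\<rho> n < m" "0 \<le> x n"
        unfolding \<rho>_def x_def by (cases "\<Sigma> (h n)"; cases "snd (\<Sigma> (h n))"; auto)+
    qed
    have agree: "run \<Sigma> (unit_instance (real m) (\<lambda>j. ereal (\<delta> j))) n = h n"
      if "\<And>j. j < n \<Longrightarrow> x j < \<delta> (\<rho> j)" for \<delta> n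
      unfolding h_def
    proof (rule run_cong)
      fix k assume "k < n"
      then have "\<not> \<delta> (\<rho> k) \<le> x k" using that[of k] by simp
      then show "explore (unit_instance (real m) (\<lambda>j. ereal (\<delta> j))) (\<Sigma> (run \<Sigma> J k))
          = explore J (\<Sigma> (run \<Sigma> J k))"
        using move[of k] by (simp add: h_def explore_def J_def)
    qed
    have opt: "opt m (unit_instance (real m) (\<lambda>j. ereal (\<delta> j)))
          = ereal (2 * sum \<delta> {..<m} - Max (\<delta> ` {..<m}))"
        "opt_size m (unit_instance (real m) (\<lambda>j. ereal (\<delta> j))) = m" for \<delta>
      using opt_unit_instance[of "{..<m}" m "\<lambda>j. ereal (\<delta> j)" \<delta>] m by (auto simp: lessThan_empty_iff)
    have mem: "unit_instance (real m) (\<lambda>j. ereal (\<delta> j)) \<in> instances m" if "\<And>j. 1 \<le> \<delta> j" for \<delta>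
      using that by (intro unit_instance_mem) (auto simp: one_ereal_def)
    show ?thesis
    proof (cases "\<exists>n. 2 * real m \<le> x n")
      \<comment> \<open>All trips without a find stay below \<open>2 * m\<close>, so targets at that
        distance are never met.\<close>
      case False
      let ?I = "unit_instance (real m) (\<lambda>j. ereal (2 * real m))"
      have "run \<Sigma> ?I n = h n" for n using False by (intro agree) (simp add: not_le)
      then have "cost \<Sigma> ?I = \<infinity>" using h_found m by (intro cost_unreached) simp
      then show ?thesis using opt[of "\<lambda>_. 2 * real m"] mem[of "\<lambda>_. 2 * real m"] m
        by (intro bexI[of _ ?I]) auto
    next
      case True
      then obtain N where N: "2 * real m \<le> x N" ..
      \<comment> \<open>Targets lie 1 beyond the total depth spent on their rays, so nothing is
        found in \<open>Suc N\<close> trips. The cost exceeds the optimum by at least twice these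
        trips, that is \<open>2 * sum \<delta> - 2 * m\<close>; this is at least the optimum
        \<open>2 * sum \<delta> - Max\<close>, as the long trip gives
        \<open>Max \<ge> 2 * m + 1\<close>.\<close>
      define y where "y = (\<lambda>r. \<Sum>j\<in>{j. j < Suc N \<and> \<rho> j = r}. x j)"
      define \<delta> where "\<delta> = (\<lambda>r. y r + 1)"
      let ?I = "unit_instance (real m) (\<lambda>j. ereal (\<delta> j))"
      have y_nonneg: "0 \<le> y r" for r unfolding y_def using valid(2) by (intro sum_nonneg) auto
      then have \<delta>_ge: "1 \<le> \<delta> r" for r by (simp add: \<delta>_def)
      have y_ge: "x j \<le> y (\<rho> j)" if "j < Suc N" for j
        unfolding y_def using that valid(2) by (intro member_le_sum) auto
      have run: "run \<Sigma> ?I (Suc N) = h (Suc N)"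
        using y_ge by (intro agree) (force simp: \<delta>_def)
      have "trips (h n) = ereal (\<Sum>j<n. x j)" for n
      proof (induction n)
        case (Suc n)
        have "h (Suc n) = (\<rho> n, ereal (x n), None) # h n"
          using J_explore[of n] move[of n] by (simp add: h_def)
        then show ?case using Suc by (simp add: add.commute)
      qed (simp add: h_def zero_ereal_def)
      then have trips: "trips (h (Suc N)) = ereal (\<Sum>j<Suc N. x j)" .
      have sum_y: "sum y {..<m} = (\<Sum>j<Suc N. x j)"
        using sum.group[of "{..<Suc N}" "{..<m}" \<rho> x] valid(1) by (auto simp: y_def)
      have "2 * real m + 1 \<le> \<delta> (\<rho> N)" using y_ge[of N] N by (simp add: \<delta>_def)
      also have "\<dots> \<le> Max (\<delta> ` {..<m})" using valid(1) by (intro Max_ge) auto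
      finally have Max: "2 * real m + 1 \<le> Max (\<delta> ` {..<m})" .
      have "sum \<delta> {..<m} = sum y {..<m} + real m" by (simp add: \<delta>_def sum.distrib)
      with Max sum_y have le: "2 * (2 * sum \<delta> {..<m} - Max (\<delta> ` {..<m}))
          \<le> 2 * sum \<delta> {..<m} - Max (\<delta> ` {..<m}) + 2 * (\<Sum>j<Suc N. x j)"
        by simp
      have "ereal (2 * sum \<delta> {..<m} - Max (\<delta> ` {..<m})) + 2 * trips (run \<Sigma> ?I (Suc N)) \<le> cost \<Sigma> ?I"
      proof -
        have "{..<m} \<inter> found_rays (run \<Sigma> ?I (Suc N)) = {}" using run h_found by simp
        then show ?thesis
          using cost_unit_instance_ge[OF \<Sigma>, of "{..<m}" "\<lambda>j. ereal (\<delta> j)" \<delta> "{..<m}" "Suc N"] \<delta>_ge m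
          by (auto simp: lessThan_empty_iff simp del: run.simps)
      qed
      then have "2 * opt m ?I \<le> cost \<Sigma> ?I"
        unfolding run trips opt(1) using le
        by (metis (no_types, lifting) ereal_less_eq(3) numeral_eq_ereal order_trans plus_ereal.simps(1) times_ereal.simps(1))
      then show ?thesis using opt[of \<delta>] mem[OF \<delta>_ge] by (intro bexI[of _ ?I]) auto
    qed
  qed
qed

theorem theorem3:
  fixes m :: nat
  assumes "2 \<le> m"
  shows
    "(\<forall>I\<in>instances m.
        (opt_size m I < m \<longrightarrow>
           cost (AdSch m) I \<le> ereal (phi (real m - real (opt_size m I))) * opt m I)
      \<and> (opt_size m I = m \<longrightarrow>
           cost (AdSch m) I \<le> ereal (3 + 2 * exp 1) * opt m I))
   \<and> (\<forall>\<Sigma>. search_strategy m \<Sigma> \<longrightarrow>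
        (\<forall>s\<in>{1..m - 1}. \<forall>\<epsilon>>0. \<exists>I\<in>instances m. opt_size m I = s
           \<and> cost \<Sigma> I \<ge> ereal (phi (real m - real (opt_size m I)) - \<epsilon>) * opt m I)
      \<and> (\<exists>I\<in>instances m. opt_size m I = m
           \<and> cost \<Sigma> I \<ge> 2 * opt m I
           \<and> (finite_depths m \<Sigma> \<longrightarrow> opt m I < \<infinity>)))"
proof -
  have "s < m" if "s \<in> {1..m - 1}" for s using that assms by auto
  then show ?thesis
    using AdSch_upper lower_bound_partial lower_bound_full[OF assms] by (intro conjI ballI allI impI) auto
qed

end
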